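(* Let $G$ be a $2P_3$-free right-Sperner bigraph with at least two vertices and let $(A,B)$ be a bipartition of $G$ such that the labeled bigraph $(G,A,B)$ is right-Sperner. Then there exists a partition of $A$ as $A = \{z\}\cup A^1\cup A^2$ and a partition of $B$ as $B = B^1\cup B^2$ such that $\{\{z\},A^1,A^2,B^1,B^2\}$ is an $M[0,0]$-partition of $G$ (rows and columns indexed in order by $\{z\},A^1,A^2,B^1,B^2$) such that the labeled bipartite subgraphs $(G_1,A^1,B^1)$ and $(G_2,A^2,B^2)$ of $(G,A,B)$ induced by $A^1\cup B^1$ and $A^2\cup B^2$ (with inherited bipartitions) are $2P_3$-free and right-Sperner. Moreover, given a $2P_3$-free bigraph $G$, one can compute in time $\mathcal{O}(|V(G)|^3)$ a bipartition $(A,B)$ of $G$ such that $(G,A,B)$ is right-Sperner, together with an $M[0,0]$-partition $\{\{z\},A^1,A^2,B^1,B^2\}$ of $G$ with $A=\{z\}\cup A^1\cup A^2$, $B=B^1\cup B^2$ such that the labeled bipartite subgraphs induced by $A^1\cup B^1$ and $A^2\cup B^2$ are $2P_3$-free and right-Sperner, or determine that $G$ is not right-Sperner.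
   Context: Graphs are finite, simple, undirected. $2P_3$ is the disjoint union of two 3-vertex paths. A labeled bigraph $(G,A,B)$ is a bipartite graph $G$ with bipartition $(A,B)$ into independent sets. It is right-Sperner if for all $u,v\in B$, $N(u)\subseteq N(v)$ implies $u=v$; a bigraph is right-Sperner if it has a bipartition making it right-Sperner. For a symmetric $m\times m$ matrix $M$ over $\{0,1,\ast\}$, an $M$-partition of $G$ is a partition of $V(G)$ into (possibly empty) parts $V_1,\dots,V_m$ such that distinct vertices in $V_i,V_j$ (possibly $i=j$) are adjacent if $M_{ij}=1$ and nonadjacent if $M_{ij}=0$ (no constraint if $\ast$). For $(a,b)\in\{0,1\}^2$, $M[a,b]=\begin{pmatrix} a&a&a&1&0\\ a&a&a&\ast&1\\ a&a&a&0&\ast\\ 1&\ast&0&b&b\\ 0&1&\ast&b&b\end{pmatrix}$. *)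

theory Defs
  imports Complex_Main "HOL-Library.Landau_Symbols"
begin

section \<open>Finite simple graphs\<close>

record 'a ugraph =
  verts :: "'a set"
  edges :: "'a set set"

definition simple_graph :: "'a ugraph \<Rightarrow> bool" where
  "simple_graph G \<longleftrightarrow> finite (verts G) \<and> (\<forall>e\<in>edges G. e \<subseteq> verts G \<and> card e = 2)"

definition adjacent :: "'a ugraph \<Rightarrow> 'a \<Rightarrow> 'a \<Rightarrow> bool" where
  "adjacent G u v \<longleftrightarrow> {u, v} \<in> edges G"

definition nbhd :: "'a ugraph \<Rightarrow> 'a \<Rightarrow> 'a set" where
  "nbhd G v = {u \<in> verts G. adjacent G u v}"

definition induced :: "'a ugraph \<Rightarrow> 'a set \<Rightarrow> 'a ugraph" where
  "induced G W = \<lparr>verts = verts G \<inter> W, edges = {e \<in> edges G. e \<subseteq> W}\<rparr>"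

definition isomorphic :: "'a ugraph \<Rightarrow> 'b ugraph \<Rightarrow> bool" where
  "isomorphic G H \<longleftrightarrow> (\<exists>f. bij_betw f (verts G) (verts H) \<and>
     (\<forall>u\<in>verts G. \<forall>v\<in>verts G. adjacent G u v \<longleftrightarrow> adjacent H (f u) (f v)))"

text \<open>\<open>H_free H G\<close>: the graph \<open>G\<close> has no \<^emph>\<open>induced\<close> subgraph isomorphic to \<open>H\<close>.\<close>

definition H_free :: "'b ugraph \<Rightarrow> 'a ugraph \<Rightarrow> bool" where
  "H_free H G \<longleftrightarrow> \<not> (\<exists>W \<subseteq> verts G. isomorphic H (induced G W))"

definition disjoint_union :: "'a ugraph \<Rightarrow> 'b ugraph \<Rightarrow> ('a + 'b) ugraph" where
  "disjoint_union G H =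
     \<lparr>verts = verts G <+> verts H, edges = image Inl ` edges G \<union> image Inr ` edges H\<rparr>"

definition P3 :: "nat ugraph" where
  "P3 = \<lparr>verts = {0, 1, 2}, edges = {{0, 1}, {1, 2}}\<rparr>"

abbreviation two_P3_free :: "'a ugraph \<Rightarrow> bool" where
  "two_P3_free \<equiv> H_free (disjoint_union P3 P3)"

section \<open>Labeled bigraphs\<close>

text \<open>The members of a list of sets partition \<open>S\<close>; members may be empty.\<close>

definition partition_into :: "'a set \<Rightarrow> 'a set list \<Rightarrow> bool" where
  "partition_into S Vs \<longleftrightarrow> \<Union> (set Vs) = S \<and>
     (\<forall>i<length Vs. \<forall>j<length Vs. i \<noteq> j \<longrightarrow> Vs ! i \<inter> Vs ! j = {})"

definition independent :: "'a ugraph \<Rightarrow> 'a set \<Rightarrow> bool" where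
  "independent G S \<longleftrightarrow> (\<forall>u\<in>S. \<forall>v\<in>S. \<not> adjacent G u v)"

definition labeled_bigraph :: "'a ugraph \<Rightarrow> 'a set \<Rightarrow> 'a set \<Rightarrow> bool" where
  "labeled_bigraph G A B \<longleftrightarrow> simple_graph G \<and> partition_into (verts G) [A, B] \<and>
     independent G A \<and> independent G B"

definition bigraph :: "'a ugraph \<Rightarrow> bool" where
  "bigraph G \<longleftrightarrow> (\<exists>A B. labeled_bigraph G A B)"

definition right_Sperner_labeled :: "'a ugraph \<Rightarrow> 'a set \<Rightarrow> 'a set \<Rightarrow> bool" where
  "right_Sperner_labeled G A B \<longleftrightarrow> labeled_bigraph G A B \<and>
     (\<forall>u\<in>B. \<forall>v\<in>B. nbhd G u \<subseteq> nbhd G v \<longrightarrow> u = v)"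

definition right_Sperner :: "'a ugraph \<Rightarrow> bool" where
  "right_Sperner G \<longleftrightarrow> (\<exists>A B. right_Sperner_labeled G A B)"

section \<open>M-partitions\<close>

datatype entry = Zero | One | Star

definition symmetric_matrix :: "entry list list \<Rightarrow> bool" where
  "symmetric_matrix M \<longleftrightarrow> (\<forall>row\<in>set M. length row = length M) \<and>
     (\<forall>i<length M. \<forall>j<length M. M ! i ! j = M ! j ! i)"

definition M_partition :: "entry list list \<Rightarrow> 'a ugraph \<Rightarrow> 'a set list \<Rightarrow> bool" where
  "M_partition M G Vs \<longleftrightarrow> symmetric_matrix M \<and> length Vs = length M \<and>
     partition_into (verts G) Vs \<and>
     (\<forall>i<length M. \<forall>j<length M. \<forall>u\<in>Vs ! i. \<forall>v\<in>Vs ! j. u \<noteq> v \<longrightarrow>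
        (M ! i ! j = One \<longrightarrow> adjacent G u v) \<and> (M ! i ! j = Zero \<longrightarrow> \<not> adjacent G u v))"

text \<open>The matrix M[a,b], used for \<open>a\<close> and \<open>b\<close> in \<open>{Zero, One}\<close>.\<close>

definition M_matrix :: "entry \<Rightarrow> entry \<Rightarrow> entry list list" where
  "M_matrix a b =
    [[a,    a,    a,    One,  Zero],
     [a,    a,    a,    Star, One ],
     [a,    a,    a,    Zero, Star],
     [One,  Star, Zero, b,    b   ],
     [Zero, One,  Star, b,    b   ]]"

definition Sperner_decomposition ::
  "'a ugraph \<Rightarrow> 'a set \<Rightarrow> 'a set \<Rightarrow> 'a \<Rightarrow> 'a set \<Rightarrow> 'a set \<Rightarrow> 'a set \<Rightarrow> 'a set \<Rightarrow> bool" where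
  "Sperner_decomposition G A B z A1 A2 B1 B2 \<longleftrightarrow>
     partition_into A [{z}, A1, A2] \<and>
     partition_into B [B1, B2] \<and>
     M_partition (M_matrix Zero Zero) G [{z}, A1, A2, B1, B2] \<and>
     two_P3_free (induced G (A1 \<union> B1)) \<and>
     right_Sperner_labeled (induced G (A1 \<union> B1)) A1 B1 \<and>
     two_P3_free (induced G (A2 \<union> B2)) \<and>
     right_Sperner_labeled (induced G (A2 \<union> B2)) A2 B2"

section \<open>A word RAM\<close>

text \<open>
  Running times refer to programs of a small imperative language over natural numbers.
  The memory consists of finitely many named arrays (only finitely many names occur in a
  program); a scalar variable is cell 0 of an array. Every operation and every array access
  has unit cost. As unit cost is meaningful only for words of logarithmic length, execution
  is relative to a bound \<open>w\<close> on all constants, memory addresses and intermediate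
  results, and a program that exceeds the bound has no execution.
\<close>

type_synonym memory = "string \<Rightarrow> nat \<Rightarrow> nat"

datatype expr =
    Const nat
  | Get string expr
  | Add expr expr
  | Sub expr expr
  | Mul expr expr
  | Less expr expr

fun eval_expr :: "expr \<Rightarrow> memory \<Rightarrow> nat" where
  "eval_expr (Const k) s = k"
| "eval_expr (Get a e) s = s a (eval_expr e s)"
| "eval_expr (Add e f) s = eval_expr e s + eval_expr f s"
| "eval_expr (Sub e f) s = eval_expr e s - eval_expr f s"
| "eval_expr (Mul e f) s = eval_expr e s * eval_expr f s"
| "eval_expr (Less e f) s = (if eval_expr e s < eval_expr f s then 1 else 0)"

fun fits :: "nat \<Rightarrow> expr \<Rightarrow> memory \<Rightarrow> bool" where
  "fits w (Const k) s \<longleftrightarrow> k \<le> w"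
| "fits w (Get a e) s \<longleftrightarrow> fits w e s \<and> eval_expr (Get a e) s \<le> w"
| "fits w (Add e f) s \<longleftrightarrow> fits w e s \<and> fits w f s \<and> eval_expr (Add e f) s \<le> w"
| "fits w (Sub e f) s \<longleftrightarrow> fits w e s \<and> fits w f s"
| "fits w (Mul e f) s \<longleftrightarrow> fits w e s \<and> fits w f s \<and> eval_expr (Mul e f) s \<le> w"
| "fits w (Less e f) s \<longleftrightarrow> fits w e s \<and> fits w f s \<and> eval_expr (Less e f) s \<le> w"

fun expr_cost :: "expr \<Rightarrow> nat" where
  "expr_cost (Const k) = 1"
| "expr_cost (Get a e) = expr_cost e + 1"
| "expr_cost (Add e f) = expr_cost e + expr_cost f + 1"
| "expr_cost (Sub e f) = expr_cost e + expr_cost f + 1"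
| "expr_cost (Mul e f) = expr_cost e + expr_cost f + 1"
| "expr_cost (Less e f) = expr_cost e + expr_cost f + 1"

datatype prog =
    Skip
  | Put string expr expr
  | Seq prog prog
  | Cond expr prog prog
  | Loop expr prog

text \<open>
  \<open>run w c s t s'\<close>: with word bound \<open>w\<close>, program \<open>c\<close> started in memory \<open>s\<close> halts after
  \<open>t\<close> steps in memory \<open>s'\<close>. The statement \<open>Put a e f\<close> is the assignment \<open>a[e] := f\<close>, and a
  condition holds if its value is nonzero.
\<close>

inductive run :: "nat \<Rightarrow> prog \<Rightarrow> memory \<Rightarrow> nat \<Rightarrow> memory \<Rightarrow> bool" for w :: nat where
  run_Skip: "run w Skip s 1 s"
| run_Put: "fits w e s \<Longrightarrow> fits w f s \<Longrightarrow>
    run w (Put a e f) s (expr_cost e + expr_cost f + 1)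
      (s(a := (s a)(eval_expr e s := eval_expr f s)))"
| run_Seq: "run w c s t s' \<Longrightarrow> run w d s' t' s'' \<Longrightarrow> run w (Seq c d) s (t + t') s''"
| run_Cond_true: "fits w e s \<Longrightarrow> eval_expr e s \<noteq> 0 \<Longrightarrow> run w c s t s' \<Longrightarrow>
    run w (Cond e c d) s (expr_cost e + 1 + t) s'"
| run_Cond_false: "fits w e s \<Longrightarrow> eval_expr e s = 0 \<Longrightarrow> run w d s t s' \<Longrightarrow>
    run w (Cond e c d) s (expr_cost e + 1 + t) s'"
| run_Loop_true: "fits w e s \<Longrightarrow> eval_expr e s \<noteq> 0 \<Longrightarrow> run w c s t s' \<Longrightarrow>
    run w (Loop e c) s' t' s'' \<Longrightarrow> run w (Loop e c) s (expr_cost e + 1 + t + t') s''"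
| run_Loop_false: "fits w e s \<Longrightarrow> eval_expr e s = 0 \<Longrightarrow>
    run w (Loop e c) s (expr_cost e + 1) s"

text \<open>
  Input: a graph with vertex set \<open>{0..<n}\<close> is given by \<open>n\<close> and its adjacency matrix, stored
  row by row; all other cells are 0.
\<close>

definition input_memory :: "nat ugraph \<Rightarrow> memory" where
  "input_memory G = (let n = card (verts G) in
     (\<lambda>a i. if a = ''n'' \<and> i = 0 then n
            else if a = ''adj'' \<and> (\<exists>u<n. \<exists>v<n. i = u * n + v \<and> adjacent G u v) then 1
            else 0))"

text \<open>
  Output: \<open>ok[0]\<close> is the verdict, and \<open>part[v]\<close> is the index in \<open>{0..4}\<close> of the part
  containing the vertex \<open>v\<close>, in the order \<open>{z}, A1, A2, B1, B2\<close>; this also encodes the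
  bipartition.
\<close>

definition output_part :: "nat ugraph \<Rightarrow> memory \<Rightarrow> nat \<Rightarrow> nat set" where
  "output_part G s i = {v \<in> verts G. s ''part'' v = i}"

definition correct_output :: "nat ugraph \<Rightarrow> memory \<Rightarrow> bool" where
  "correct_output G s \<longleftrightarrow>
     (s ''ok'' 0 = 1 \<and>
      (\<exists>z A1 A2 B1 B2 A B.
         {z} = output_part G s 0 \<and> A1 = output_part G s 1 \<and> A2 = output_part G s 2 \<and>
         B1 = output_part G s 3 \<and> B2 = output_part G s 4 \<and>
         A = {z} \<union> A1 \<union> A2 \<and> B = B1 \<union> B2 \<and>
         right_Sperner_labeled G A B \<and> Sperner_decomposition G A B z A1 A2 B1 B2)) \<or>
     (s ''ok'' 0 = 0 \<and> \<not> right_Sperner G)"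

text \<open>
  One program works for all nonempty inputs on which the promise \<open>P\<close> holds; the word bound
  \<open>(n + 2) ^ k\<close> corresponds to words of \<open>O(log n)\<close> bits.
  The empty graph is excluded: it is vacuously right-Sperner but has no vertex \<open>z\<close>.
\<close>

definition computable_in_time ::
  "(nat \<Rightarrow> real) \<Rightarrow> (nat ugraph \<Rightarrow> bool) \<Rightarrow> (nat ugraph \<Rightarrow> memory \<Rightarrow> bool) \<Rightarrow> bool" where
  "computable_in_time f P Q \<longleftrightarrow>
     (\<exists>c k. \<exists>T :: nat \<Rightarrow> nat. (\<lambda>n. real (T n)) \<in> O(f) \<and>
        (\<forall>G n. n \<ge> 1 \<and> verts G = {0..<n} \<and> simple_graph G \<and> P G \<longrightarrow>
           (\<exists>t s. run ((n + 2) ^ k) c (input_memory G) t s \<and> t \<le> T n \<and> Q G s)))"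

end

theory Submission
  imports Defs
begin

text \<open>
  The decomposition amounts to a vertex \<open>z\<close> in \<open>A\<close> such that for every other \<open>a\<close> in \<open>A\<close> the sets
  \<open>N(a)\<close> and \<open>N(z)\<close> are disjoint or cover \<open>B\<close>; then \<open>B1 = N(z)\<close>, and \<open>A1\<close> collects the \<open>a\<close> whose
  neighborhood meets \<open>N(z)\<close>. As \<open>2P3\<close>-freeness makes the family of the \<open>N(b)\<close>, \<open>b\<close> in \<open>B\<close>, a
  1-Sperner hypergraph, such a \<open>z\<close> is found as follows: let \<open>e\<close> be a largest hyperedge and \<open>f\<close> a
  smallest one different from \<open>e\<close>, and take the only element of \<open>f - e\<close>.

  For the algorithm, two vertices of degree at least 2 lie on the same side iff they have a common
  neighbor. This gives two candidates for \<open>B\<close> with opposite colors and no isolated vertex. A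
  violation of the Sperner property in a candidate produces a vertex of degree at least 2 on the
  other side; if both candidates are violated, then these two vertices lie on different sides of
  every bipartition, so that every bipartition is violated. All of this is first-order definable
  over previously computed arrays with two nested quantifiers per vertex, and such definitions are
  compiled to nested loops.
\<close>

section \<open>Graphs and labeled bigraphs\<close>

lemma adjacent_sym: "adjacent G u v \<longleftrightarrow> adjacent G v u"
  by (simp add: adjacent_def insert_commute)

lemma adjacent_verts:
  assumes "simple_graph G" "adjacent G u v"
  shows "u \<in> verts G" "v \<in> verts G" "u \<noteq> v"
  using assms by (auto simp: simple_graph_def adjacent_def)

lemma nbhd_iff: "simple_graph G \<Longrightarrow> x \<in> nbhd G v \<longleftrightarrow> adjacent G x v"
  using adjacent_verts(1) by (fastforce simp: nbhd_def)

lemma verts_induced [simp]: "verts (induced G W) = verts G \<inter> W"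
  by (simp add: induced_def)

lemma adjacent_induced [simp]:
  "adjacent (induced G W) u v \<longleftrightarrow> adjacent G u v \<and> u \<in> W \<and> v \<in> W"
  by (auto simp: induced_def adjacent_def)

lemma simple_graph_induced: "simple_graph G \<Longrightarrow> simple_graph (induced G W)"
  by (auto simp: simple_graph_def induced_def)

lemma H_free_induced:
  assumes "H_free H G"
  shows "H_free H (induced G W)"
proof -
  have "induced (induced G W) W' = induced G W'" if "W' \<subseteq> W" for W'
    using that by (auto simp: induced_def)
  with assms show ?thesis
    by (auto simp: H_free_def)
qed

text \<open>The working form of a bipartition: adjacent vertices belong to \<open>verts G\<close>
  and the sides are disjoint, so independence of both sides becomes the single statement that every
  edge changes sides.\<close>

lemma labeled_bigraph_iff:
  "labeled_bigraph G A B \<longleftrightarrow> simple_graph G \<and> A \<union> B = verts G \<and> A \<inter> B = {} \<and>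
     (\<forall>u v. adjacent G u v \<longrightarrow> (u \<in> A \<longleftrightarrow> v \<notin> A))"
  (is "?L \<longleftrightarrow> ?R")
proof
  assume L: ?L
  then have "A \<union> B = verts G" "A \<inter> B = {}"
    by (force simp: labeled_bigraph_def partition_into_def)+
  with L show ?R
    using adjacent_verts[of G]
    unfolding labeled_bigraph_def independent_def by (metis IntI Un_iff empty_iff)
next
  assume ?R
  then have "partition_into (verts G) [A, B]"
    by (auto simp: partition_into_def less_Suc_eq nth_Cons')
  with \<open>?R\<close> show ?L
    by (simp add: labeled_bigraph_def independent_def) blast
qed

section \<open>Induced copies of two disjoint three-vertex paths\<close>

lemma adjacent_P3:
  "adjacent P3 i j \<longleftrightarrow> (i = 0 \<and> j = 1) \<or> (i = 1 \<and> j = 0) \<or> (i = 1 \<and> j = 2) \<or> (i = 2 \<and> j = 1)"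
  by (auto simp: adjacent_def P3_def doubleton_eq_iff)

text \<open>Tagging is injective on sets, so it preserves and reflects edges within a summand; a
  pair with an \<open>Inr\<close> member is not an image under \<open>Inl\<close>, and vice
  versa.\<close>

lemma adjacent_disjoint_union [simp]:
  "adjacent (disjoint_union G H) (Inl u) (Inl v) \<longleftrightarrow> adjacent G u v"
  "adjacent (disjoint_union G H) (Inr p) (Inr q) \<longleftrightarrow> adjacent H p q"
  "\<not> adjacent (disjoint_union G H) (Inl u) (Inr p)"
  "\<not> adjacent (disjoint_union G H) (Inr p) (Inl u)"
proof -
  have l: "Inl ` {u, v} \<in> image Inl ` edges G \<longleftrightarrow> {u, v} \<in> edges G"
    by (rule inj_image_mem_iff) (simp add: inj_def inj_image_eq_iff)
  have r: "Inr ` {p, q} \<in> image Inr ` edges H \<longleftrightarrow> {p, q} \<in> edges H"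
    by (rule inj_image_mem_iff) (simp add: inj_def inj_image_eq_iff)
  have Inl: "x \<notin> X" if "X \<in> image Inl ` E" "x = Inr y"
    for x :: "'c + 'd" and X E y using that by auto
  have Inr: "x \<notin> X" if "X \<in> image Inr ` E" "x = Inl y"
    for x :: "'c + 'd" and X E y using that by auto
  have e: "adjacent (disjoint_union G H) x y \<longleftrightarrow>
      {x, y} \<in> image Inl ` edges G \<or> {x, y} \<in> image Inr ` edges H" for x y
    by (simp add: adjacent_def disjoint_union_def)
  show "adjacent (disjoint_union G H) (Inl u) (Inl v) \<longleftrightarrow> adjacent G u v"
    using l Inr[of "{Inl u, Inl v}" "edges H" "Inl u" u] unfolding e by (simp add: adjacent_def) blast
  show "adjacent (disjoint_union G H) (Inr p) (Inr q) \<longleftrightarrow> adjacent H p q"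
    using r Inl[of "{Inr p, Inr q}" "edges G" "Inr p" p] unfolding e by (simp add: adjacent_def) blast
  show "\<not> adjacent (disjoint_union G H) (Inl u) (Inr p)"
    using Inl[of "{Inl u, Inr p}" "edges G" "Inr p" p] Inr[of "{Inl u, Inr p}" "edges H" "Inl u" u]
    unfolding e by blast
  show "\<not> adjacent (disjoint_union G H) (Inr p) (Inl u)"
    using Inl[of "{Inr p, Inl u}" "edges G" "Inr p" p] Inr[of "{Inr p, Inl u}" "edges H" "Inl u" u]
    unfolding e by blast
qed

text \<open>The paths x u y and x' v y' form an induced 2P3: the four ends lie on the side opposite
  to \<open>u\<close> and \<open>v\<close>, so there is no edge among them or between the centers,
  and the remaining non-edges are assumed.\<close>

lemma two_P3_free_same_side:
  assumes bg: "labeled_bigraph G A B" and free: "two_P3_free G"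
    and side: "u \<in> A \<longleftrightarrow> v \<in> A"
    and x: "adjacent G x u" "adjacent G y u" "\<not> adjacent G x v" "\<not> adjacent G y v" "x \<noteq> y"
    and x': "adjacent G x' v" "adjacent G y' v" "\<not> adjacent G x' u" "\<not> adjacent G y' u" "x' \<noteq> y'"
  shows False
proof -
  from bg have sg: "simple_graph G"
    and alt: "\<And>a b. adjacent G a b \<Longrightarrow> a \<in> A \<longleftrightarrow> b \<notin> A"
    by (auto simp: labeled_bigraph_iff)
  let ?g = "case_sum (\<lambda>i. if i = (0::nat) then x else if i = 1 then u else y)
                     (\<lambda>i. if i = (0::nat) then x' else if i = 1 then v else y')"
  let ?W = "{x, u, y, x', v, y'}"
  have V: "?W \<subseteq> verts G"
    using adjacent_verts[OF sg x(1)] adjacent_verts[OF sg x(2)]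
      adjacent_verts[OF sg x'(1)] adjacent_verts[OF sg x'(2)] by auto
  have sides: "x \<in> A \<longleftrightarrow> u \<notin> A" "y \<in> A \<longleftrightarrow> u \<notin> A" "x' \<in> A \<longleftrightarrow> u \<notin> A" "y' \<in> A \<longleftrightarrow> u \<notin> A"
    using alt x(1,2) x'(1,2) side by blast+
  then have ne: "x \<noteq> u" "x \<noteq> v" "y \<noteq> u" "y \<noteq> v" "x' \<noteq> u" "x' \<noteq> v" "y' \<noteq> u" "y' \<noteq> v"
    using side by blast+
  have ne': "u \<noteq> v" "x \<noteq> x'" "x \<noteq> y'" "y \<noteq> x'" "y \<noteq> y'"
    using x x' by blast+
  have nadj: "\<not> adjacent G p q" if "p \<in> {x, y, x', y'}" "q \<in> {x, y, x', y'}" for p q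
    using alt[of p q] that sides by auto
  have nuv: "\<not> adjacent G p q" if "p \<in> {u, v}" "q \<in> {u, v}" for p q
    using alt[of p q] that side by auto
  have sx: "adjacent G u x" "adjacent G u y" "\<not> adjacent G v x" "\<not> adjacent G v y"
    "adjacent G v x'" "adjacent G v y'" "\<not> adjacent G u x'" "\<not> adjacent G u y'"
    using x x' by (simp_all add: adjacent_sym)
  have dom: "verts (disjoint_union P3 P3) =
      {Inl 0, Inl 1, Inl 2, Inr 0, Inr 1, Inr 2}"
    by (auto simp: disjoint_union_def P3_def)
  have "inj_on ?g {Inl 0, Inl 1, Inl 2, Inr 0, Inr 1, Inr 2}"
    using ne ne' ne[symmetric] ne'[symmetric] x(5) x'(5) by (simp add: inj_on_def)
  moreover have "?g ` {Inl 0, Inl 1, Inl 2, Inr 0, Inr 1, Inr 2} = verts G \<inter> ?W"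
    using V by auto
  ultimately have bij: "bij_betw ?g (verts (disjoint_union P3 P3)) (verts (induced G ?W))"
    by (simp add: bij_betw_def dom)
  have "\<forall>p\<in>{Inl 0, Inl 1, Inl 2, Inr 0, Inr 1, Inr 2}. \<forall>q\<in>{Inl 0, Inl 1, Inl 2, Inr 0, Inr 1, Inr 2}.
      adjacent (disjoint_union P3 P3) p q \<longleftrightarrow> adjacent (induced G ?W) (?g p) (?g q)"
    by (simp add: adjacent_P3 x x' sx nadj nuv)
  then have adj: "\<forall>p\<in>verts (disjoint_union P3 P3). \<forall>q\<in>verts (disjoint_union P3 P3).
      adjacent (disjoint_union P3 P3) p q \<longleftrightarrow> adjacent (induced G ?W) (?g p) (?g q)"
    unfolding dom .
  have iso: "isomorphic (disjoint_union P3 P3) (induced G ?W)"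
    unfolding isomorphic_def
    by (rule exI[of _ ?g]) (rule conjI[OF bij adj])
  have "\<exists>W \<subseteq> verts G. isomorphic (disjoint_union P3 P3) (induced G W)"
    by (rule exI[of _ ?W]) (rule conjI[OF V iso])
  with free show False
    by (simp add: H_free_def)
qed

section \<open>The decomposition of 1-Sperner hypergraphs\<close>

lemma is_singleton_or_two:
  "S \<noteq> {} \<Longrightarrow> \<not> is_singleton S \<Longrightarrow> \<exists>x\<in>S. \<exists>y\<in>S. x \<noteq> y"
  using is_singletonI'[of S] by blast

text \<open>Both differences are nonempty by the Sperner property. If each had two elements, these
  would be the ends of two disjoint induced paths centered at \<open>u\<close> and
  \<open>v\<close>.\<close>

lemma nbhd_1_Sperner:
  assumes rs: "right_Sperner_labeled G A B" and free: "two_P3_free G"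
    and uv: "u \<in> B" "v \<in> B" "u \<noteq> v"
  shows "is_singleton (nbhd G u - nbhd G v) \<or> is_singleton (nbhd G v - nbhd G u)"
proof (rule ccontr)
  assume no: "\<not> ?thesis"
  from rs have bg: "labeled_bigraph G A B" by (simp add: right_Sperner_labeled_def)
  then have sg: "simple_graph G" and side: "u \<in> A \<longleftrightarrow> v \<in> A"
    using uv by (auto simp: labeled_bigraph_iff)
  have "nbhd G u - nbhd G v \<noteq> {}" "nbhd G v - nbhd G u \<noteq> {}"
    using rs uv by (auto simp: right_Sperner_labeled_def)
  with no obtain x y x' y' where
    "x \<in> nbhd G u - nbhd G v" "y \<in> nbhd G u - nbhd G v" "x \<noteq> y"
    and "x' \<in> nbhd G v - nbhd G u" "y' \<in> nbhd G v - nbhd G u" "x' \<noteq> y'"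
    by (meson is_singleton_or_two)
  then show False
    using two_P3_free_same_side[OF bg free side, of x y x' y'] unfolding Diff_iff nbhd_iff[OF sg]
    by blast
qed

lemma is_singleton_eq: "is_singleton S \<Longrightarrow> z \<in> S \<Longrightarrow> S = {z}"
  by (auto simp: is_singleton_def)

text \<open>The extremal choice of \<open>e\<close> and \<open>f\<close> controls the direction of
  the singleton differences: every other hyperedge has exactly one element outside \<open>e\<close>,
  and \<open>f\<close> has exactly one element outside each other hyperedge.\<close>

lemma one_Sperner_decomposition_vertex:
  assumes fin: "finite F" "\<And>e. e \<in> F \<Longrightarrow> finite e" "\<And>e. e \<in> F \<Longrightarrow> e \<subseteq> V"
    and antichain: "\<And>e f. e \<in> F \<Longrightarrow> f \<in> F \<Longrightarrow> e \<subseteq> f \<Longrightarrow> e = f"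
    and one: "\<And>e f. e \<in> F \<Longrightarrow> f \<in> F \<Longrightarrow> e \<noteq> f \<Longrightarrow> is_singleton (e - f) \<or> is_singleton (f - e)"
    and "V \<noteq> {}"
  shows "\<exists>z\<in>V. \<forall>f\<in>F. \<forall>e\<in>F. z \<in> f \<longrightarrow> z \<notin> e \<longrightarrow> f - e = {z}"
proof (cases "\<exists>e\<in>F. \<exists>f\<in>F. e \<noteq> f")
  \<comment> \<open>With at most one hyperedge the condition is vacuous, and any vertex
    serves.\<close>
  case False
  with \<open>V \<noteq> {}\<close> show ?thesis by (metis all_not_in_conv)
next
  case True
  \<comment> \<open>The antichain condition makes f - e nonempty, and its size is at most that of e
    - f; so whichever of the two differences is a singleton, f - e is one.\<close>
  have small: "is_singleton (f - e)" if "e \<in> F" "f \<in> F" "e \<noteq> f" "card f \<le> card e" for e f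
  proof -
    have "card (f - e) \<le> card (e - f)"
      using that fin(2) by (metis card_le_sym_Diff)
    moreover have "f - e \<noteq> {}" using antichain[of f e] that by auto
    ultimately show ?thesis
      using one[OF that(1-3)] fin(2)[OF that(2)]
      by (metis One_nat_def card_eq_0_iff card_gt_0_iff finite_Diff is_singleton_altdef
          le_antisym less_eq_Suc_le)
  qed
  from True have "card ` F \<noteq> {}" by auto
  then have "Max (card ` F) \<in> card ` F" using fin(1) by (intro Max_in) auto
  then obtain e where "e \<in> F" "card e = Max (card ` F)" by auto
  with fin(1) have e: "e \<in> F" "\<And>f. f \<in> F \<Longrightarrow> card f \<le> card e"
    by (auto intro: Max_ge)
  from True e have ne: "card ` (F - {e}) \<noteq> {}" by auto
  then have "Min (card ` (F - {e})) \<in> card ` (F - {e})" using fin(1) by (intro Min_in) auto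
  then obtain f where "f \<in> F - {e}" "card f = Min (card ` (F - {e}))" by (metis imageE)
  with fin(1) have f: "f \<in> F" "f \<noteq> e" "\<And>g. g \<in> F \<Longrightarrow> g \<noteq> e \<Longrightarrow> card f \<le> card g"
    by (auto intro: Min_le)
  obtain z where z: "f - e = {z}"
    using small[of e f] e f by (auto simp: is_singleton_def)
  have "g - h = {z}" if g: "g \<in> F" "z \<in> g" and h: "h \<in> F" "z \<notin> h" for g h
  proof -
    have "g \<noteq> e" using z g by auto
    have ge: "g - e = {z}"
      by (rule is_singleton_eq) (use small[of e g] e g \<open>g \<noteq> e\<close> z in auto)
    show ?thesis
    proof (cases "h = e")
      case True with ge show ?thesis by simp
    next
      case False
      obtain z' where z': "h - e = {z'}"
        using small[of e h] e h False by (auto simp: is_singleton_def)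
      have "f \<noteq> h" using z h by auto
      have fh: "f - h = {z}"
        by (rule is_singleton_eq) (use \<open>f \<noteq> h\<close> small[of h f] f h False z in auto)
      have "g \<noteq> h" using g h by auto
      then consider "is_singleton (g - h)" | "is_singleton (h - g)"
        using one g h by blast
      then show ?thesis
      proof cases
        case 1 with g h show ?thesis by (simp add: is_singleton_eq)
      next
        case 2
        \<comment> \<open>\<open>g\<close> exceeds \<open>e\<close> only by \<open>z\<close>, which
          is not in \<open>h\<close>; so the element \<open>z'\<close> of \<open>h\<close> outside
          \<open>e\<close> is also outside \<open>g\<close>.\<close>
        have "z' \<in> h - g" using z' ge h by auto
        with 2 have "h - g = {z'}" by (rule is_singleton_eq)
        \<comment> \<open>Apart from \<open>z\<close>, the set \<open>f\<close> lies in both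
          \<open>h\<close> and \<open>e\<close>; hence it avoids \<open>z'\<close>, the only element
          of \<open>h\<close> missing from \<open>g\<close>. The antichain condition then gives
          \<open>f = g\<close>.\<close>
        have "f \<subseteq> g"
        proof
          fix x assume "x \<in> f"
          show "x \<in> g"
          proof (cases "x = z")
            case False
            with \<open>x \<in> f\<close> fh z have "x \<in> h" "x \<in> e" by blast+
            moreover have "z' \<notin> e" using z' by blast
            ultimately show ?thesis using \<open>h - g = {z'}\<close> by (metis DiffI singletonD)
          qed (use g in simp)
        qed
        then have "f = g" using antichain f g by blast
        with fh show ?thesis by simp
      qed
    qed
  qed
  moreover have "z \<in> V" using z f fin(3) by blast
  ultimately show ?thesis by blast
qed

section \<open>Splitting vertices and the decompositions they induce\<close>

definition splitting_vertex :: "'a ugraph \<Rightarrow> 'a set \<Rightarrow> 'a set \<Rightarrow> 'a \<Rightarrow> bool" where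
  "splitting_vertex G A B z \<longleftrightarrow> z \<in> A \<and>
     (\<forall>a\<in>A. a \<noteq> z \<longrightarrow> nbhd G a \<inter> nbhd G z = {} \<or> B \<subseteq> nbhd G a \<union> nbhd G z)"

text \<open>The hypergraph consists of the neighborhoods of \<open>B\<close> on the vertex set
  \<open>A\<close>, and its condition on \<open>z\<close> is transposed: if x is in both N(a) and
  N(z) while y in \<open>B\<close> is in neither, then \<open>a\<close> and \<open>z\<close> both
  lie in N(x) - N(y), which is only {z}.\<close>

lemma splitting_vertex_exists:
  assumes rs: "right_Sperner_labeled G A B" and free: "two_P3_free G" and "A \<noteq> {}"
  shows "\<exists>z. splitting_vertex G A B z"
proof -
  from rs have bg: "labeled_bigraph G A B" by (simp add: right_Sperner_labeled_def)
  then have sg: "simple_graph G" and V: "A \<union> B = verts G" "A \<inter> B = {}"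
    and alt: "\<And>a b. adjacent G a b \<Longrightarrow> a \<in> A \<longleftrightarrow> b \<notin> A"
    by (auto simp: labeled_bigraph_iff)
  have finV: "finite (verts G)" using sg by (simp add: simple_graph_def)
  have sub: "nbhd G b \<subseteq> A" if "b \<in> B" for b
    using that alt V by (auto simp: nbhd_def)
  have "\<exists>z\<in>A. \<forall>f\<in>nbhd G ` B. \<forall>e\<in>nbhd G ` B. z \<in> f \<longrightarrow> z \<notin> e \<longrightarrow> f - e = {z}"
  proof (rule one_Sperner_decomposition_vertex)
    have fin: "finite A" "finite B" using finV V(1) by (metis finite_Un)+
    then show "finite (nbhd G ` B)" by simp
    show sub': "e \<subseteq> A" if "e \<in> nbhd G ` B" for e
      using that sub by blast
    then show "finite e" if "e \<in> nbhd G ` B" for e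
      using that fin(1) finite_subset by blast
    show "e = f" if "e \<in> nbhd G ` B" "f \<in> nbhd G ` B" "e \<subseteq> f" for e f
      using that rs unfolding right_Sperner_labeled_def by blast
    show "is_singleton (e - f) \<or> is_singleton (f - e)"
      if "e \<in> nbhd G ` B" "f \<in> nbhd G ` B" "e \<noteq> f" for e f
    proof -
      from that(1,2) obtain x y where "x \<in> B" "y \<in> B" "e = nbhd G x" "f = nbhd G y"
        by (elim imageE)
      with that(3) nbhd_1_Sperner[OF rs free, of x y] show ?thesis
        by (cases "x = y") simp_all
    qed
  qed fact
  then obtain z where z1: "z \<in> A"
    and "\<forall>f\<in>nbhd G ` B. \<forall>e\<in>nbhd G ` B. z \<in> f \<longrightarrow> z \<notin> e \<longrightarrow> f - e = {z}" ..
  then have z: "nbhd G x - nbhd G y = {z}"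
    if "x \<in> B" "y \<in> B" "z \<in> nbhd G x" "z \<notin> nbhd G y" for x y
    using that by simp
  have "splitting_vertex G A B z"
    unfolding splitting_vertex_def
  proof (intro conjI ballI impI)
    fix a assume a: "a \<in> A" "a \<noteq> z"
    show "nbhd G a \<inter> nbhd G z = {} \<or> B \<subseteq> nbhd G a \<union> nbhd G z"
    proof (rule ccontr)
      assume "\<not> ?thesis"
      then obtain x y where xy: "adjacent G x a" "adjacent G x z" "y \<in> B"
        "\<not> adjacent G y a" "\<not> adjacent G y z"
        by (auto simp: nbhd_iff[OF sg])
      moreover have "x \<in> B"
        using xy(1) a alt[of x a] adjacent_verts[OF sg xy(1)] V by blast
      ultimately have "nbhd G x - nbhd G y = {z}"
        using z[of x y] by (simp add: nbhd_iff[OF sg] adjacent_sym)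
      moreover have "a \<in> nbhd G x - nbhd G y"
        using xy by (simp add: nbhd_iff[OF sg] adjacent_sym)
      ultimately show False using a by simp
    qed
  qed (fact z1)
  then show ?thesis ..
qed

text \<open>By \<open>const\<close>, each left vertex that is dropped sees all of \<open>B'\<close>
  or none of it, so it cannot tell two vertices of \<open>B'\<close> apart; an inclusion of
  neighborhoods in the induced graph is then already one in \<open>G\<close>.\<close>

lemma right_Sperner_labeled_induced:
  assumes rs: "right_Sperner_labeled G A B" and sub: "A' \<subseteq> A" "B' \<subseteq> B"
    and const: "\<And>a u v. a \<in> A - A' \<Longrightarrow> u \<in> B' \<Longrightarrow> v \<in> B' \<Longrightarrow> adjacent G a u \<longleftrightarrow> adjacent G a v"
  shows "right_Sperner_labeled (induced G (A' \<union> B')) A' B'"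
proof -
  from rs have bg: "labeled_bigraph G A B" by (simp add: right_Sperner_labeled_def)
  then have sg: "simple_graph G" and V: "A \<union> B = verts G" "A \<inter> B = {}"
    and alt: "\<And>a b. adjacent G a b \<Longrightarrow> a \<in> A \<longleftrightarrow> b \<notin> A"
    by (auto simp: labeled_bigraph_iff)
  have sg': "simple_graph (induced G (A' \<union> B'))" by (rule simple_graph_induced[OF sg])
  have bg': "labeled_bigraph (induced G (A' \<union> B')) A' B'"
    unfolding labeled_bigraph_iff
  proof (intro conjI allI impI)
    show "A' \<union> B' = verts (induced G (A' \<union> B'))" "A' \<inter> B' = {}"
      using V sub by auto
    fix u v assume "adjacent (induced G (A' \<union> B')) u v"
    with alt[of u v] V sub show "u \<in> A' \<longleftrightarrow> v \<notin> A'"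
      unfolding adjacent_induced by blast
  qed (rule sg')
  have "u = v" if uv: "u \<in> B'" "v \<in> B'"
    and le: "nbhd (induced G (A' \<union> B')) u \<subseteq> nbhd (induced G (A' \<union> B')) v" for u v
  proof -
    have "nbhd G u \<subseteq> nbhd G v"
    proof
      fix a assume "a \<in> nbhd G u"
      then have au: "adjacent G a u" by (simp add: nbhd_iff[OF sg])
      then have "a \<in> A" using alt[OF au] adjacent_verts[OF sg au] uv sub V by blast
      show "a \<in> nbhd G v"
      proof (cases "a \<in> A'")
        case True
        with au uv have "a \<in> nbhd (induced G (A' \<union> B')) u"
          by (simp add: nbhd_iff[OF sg'])
        with le show ?thesis by (auto simp: nbhd_iff[OF sg'] nbhd_iff[OF sg])
      next
        case False
        with const[of a u v] au uv \<open>a \<in> A\<close> show ?thesis by (simp add: nbhd_iff[OF sg])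
      qed
    qed
    with rs uv sub show ?thesis unfolding right_Sperner_labeled_def by blast
  qed
  with bg' show ?thesis by (simp add: right_Sperner_labeled_def)
qed

lemma Sperner_decomposition_splitting_vertex:
  assumes rs: "right_Sperner_labeled G A B" and free: "two_P3_free G"
    and z: "splitting_vertex G A B z"
    and A1: "A1 = {a \<in> A - {z}. nbhd G a \<inter> nbhd G z \<noteq> {}}"
    and A2: "A2 = {a \<in> A - {z}. nbhd G a \<inter> nbhd G z = {}}"
    and B1: "B1 = B \<inter> nbhd G z" and B2: "B2 = B - nbhd G z"
  shows "Sperner_decomposition G A B z A1 A2 B1 B2"
proof -
  from rs have bg: "labeled_bigraph G A B" by (simp add: right_Sperner_labeled_def)
  then have sg: "simple_graph G" and V: "A \<union> B = verts G" "A \<inter> B = {}"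
    and alt: "\<And>a b. adjacent G a b \<Longrightarrow> a \<in> A \<longleftrightarrow> b \<notin> A"
    by (auto simp: labeled_bigraph_iff)
  have zA: "z \<in> A" using z by (simp add: splitting_vertex_def)
  have i4: "i < 5 \<longleftrightarrow> i = 0 \<or> i = 1 \<or> i = 2 \<or> i = 3 \<or> i = (4::nat)" for i by auto
  have zB1: "adjacent G z b" if "b \<in> B1" for b
    using that B1 by (auto simp: nbhd_iff[OF sg] adjacent_sym)
  have zB2: "\<not> adjacent G z b" if "b \<in> B2" for b
    using that B2 by (auto simp: nbhd_iff[OF sg] adjacent_sym)
  \<comment> \<open>The only block of the matrix that rests on the splitting condition: N(a) meets
    N(z), so together they cover \<open>B\<close>, and \<open>b\<close> is not in N(z).\<close>
  have A1B2: "adjacent G a b" if "a \<in> A1" "b \<in> B2" for a b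
  proof -
    have "a \<in> A" "a \<noteq> z" "nbhd G a \<inter> nbhd G z \<noteq> {}" "b \<in> B" "b \<notin> nbhd G z"
      using that A1 B2 by auto
    with z have "b \<in> nbhd G a" unfolding splitting_vertex_def by blast
    then show ?thesis by (simp add: nbhd_iff[OF sg] adjacent_sym)
  qed
  have A2B1: "\<not> adjacent G a b" if "a \<in> A2" "b \<in> B1" for a b
    using that A2 B1 by (auto simp: nbhd_iff[OF sg] adjacent_sym)
  \<comment> \<open>Both orders are supplied, as the definition of an \<open>M\<close>-partition
    ranges over all ordered pairs of parts.\<close>
  note sym_facts = zB1 zB2 A1B2 A2B1
    zB1[THEN adjacent_sym[THEN iffD1]] zB2[THEN contrapos_nn, OF _ adjacent_sym[THEN iffD1]]
    A1B2[THEN adjacent_sym[THEN iffD1]] A2B1[THEN contrapos_nn, OF _ _ adjacent_sym[THEN iffD1]]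
  have AA: "\<not> adjacent G a a'" if "a \<in> A" "a' \<in> A" for a a'
    using alt that by blast
  have BB: "\<not> adjacent G b b'" if "b \<in> B" "b' \<in> B" for b b'
    using alt[of b b'] that V by blast
  have pA: "partition_into A [{z}, A1, A2]" and pB: "partition_into B [B1, B2]"
    using zA A1 A2 B1 B2
    by (auto simp: partition_into_def less_Suc_eq nth_Cons')
  have Un: "{z} \<union> A1 \<union> A2 = A" "B1 \<union> B2 = B" using zA A1 A2 B1 B2 by auto
  have pV: "partition_into (verts G) [{z}, A1, A2, B1, B2]"
    unfolding partition_into_def
    using zA A1 A2 B1 B2 V by (auto simp: less_Suc_eq nth_Cons')
  have sym: "symmetric_matrix (M_matrix Zero Zero)"
    by (auto simp: symmetric_matrix_def M_matrix_def less_Suc_eq)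
  have len: "length (M_matrix Zero Zero) = 5" by (simp add: M_matrix_def)
  have subs: "A1 \<subseteq> A" "A2 \<subseteq> A" "B1 \<subseteq> B" "B2 \<subseteq> B" using Un by auto
  have "M_partition (M_matrix Zero Zero) G [{z}, A1, A2, B1, B2]"
    unfolding M_partition_def len
  proof (intro conjI allI impI ballI)
    fix i j :: nat and u v
    assume ij: "i < 5" "j < 5" and uv: "u \<in> [{z}, A1, A2, B1, B2] ! i" "v \<in> [{z}, A1, A2, B1, B2] ! j"
    show "adjacent G u v" if "M_matrix Zero Zero ! i ! j = One"
      using ij uv that sym_facts unfolding i4 M_matrix_def
      by (elim disjE) simp_all
    show "\<not> adjacent G u v" if "M_matrix Zero Zero ! i ! j = Zero"
      using ij uv that sym_facts AA BB zA subs unfolding i4 M_matrix_def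
      by (elim disjE) (simp_all add: subset_iff)
  qed (use sym pV in simp_all)
  \<comment> \<open>The dropped left vertices are constant on \<open>B1\<close>: \<open>z\<close>
    sees all of it and \<open>A2\<close> nothing. On \<open>B2\<close>, in turn, \<open>z\<close>
    sees nothing and \<open>A1\<close> everything.\<close>
  moreover have "right_Sperner_labeled (induced G (A1 \<union> B1)) A1 B1"
    by (rule right_Sperner_labeled_induced[OF rs])
      (use subs Un zB1 A2B1 in auto)
  moreover have "right_Sperner_labeled (induced G (A2 \<union> B2)) A2 B2"
    by (rule right_Sperner_labeled_induced[OF rs])
      (use subs Un zB2 A1B2 in auto)
  ultimately show ?thesis
    using pA pB H_free_induced[OF free] by (simp add: Sperner_decomposition_def)
qed

lemma Sperner_decomposition_exists:
  assumes rs: "right_Sperner_labeled G A B" and free: "two_P3_free G" and card: "card (verts G) \<ge> 2"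
  shows "\<exists>z A1 A2 B1 B2. Sperner_decomposition G A B z A1 A2 B1 B2"
proof -
  \<comment> \<open>If \<open>A\<close> were empty, all neighborhoods would be empty, so the Sperner
    property would leave at most one vertex in \<open>B\<close>, against the two vertices
    assumed.\<close>
  have "A \<noteq> {}"
  proof
    assume "A = {}"
    with rs have bg: "labeled_bigraph G {} B" by (simp add: right_Sperner_labeled_def)
    then have "\<not> adjacent G u v" for u v by (auto simp: labeled_bigraph_iff)
    then have "\<forall>u\<in>B. \<forall>v\<in>B. u = v"
      using rs by (auto simp: right_Sperner_labeled_def nbhd_def)
    then have "card B \<le> 1" by (metis card_eq_0_iff card_le_Suc0_iff_eq One_nat_def zero_le)
    with bg card show False by (auto simp: labeled_bigraph_iff)
  qed
  with splitting_vertex_exists[OF rs free] Sperner_decomposition_splitting_vertex[OF rs free]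
  show ?thesis by blast
qed

section \<open>Computing first-order definable sets\<close>

text \<open>
  Variables are de Bruijn levels: \<open>Ex\<close> binds the variable whose number is the current level, and
  quantifiers range over \<open>{0..<n}\<close>. In programs, the variable \<open>i\<close> is the cell \<open>v[i]\<close>, and the cell
  \<open>r[0]\<close> receives truth values.
\<close>

datatype fm = Edge nat nat | In string nat | Lt nat nat | Neg fm | And fm fm | Ex fm

fun sat :: "memory \<Rightarrow> nat \<Rightarrow> (nat \<Rightarrow> nat) \<Rightarrow> fm \<Rightarrow> bool" where
  "sat s l e (Edge i j) \<longleftrightarrow> 0 < s ''adj'' (e i * s ''n'' 0 + e j)"
| "sat s l e (In a i) \<longleftrightarrow> 0 < s a (e i)"
| "sat s l e (Lt i j) \<longleftrightarrow> e i < e j"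
| "sat s l e (Neg \<phi>) \<longleftrightarrow> \<not> sat s l e \<phi>"
| "sat s l e (And \<phi> \<psi>) \<longleftrightarrow> sat s l e \<phi> \<and> sat s l e \<psi>"
| "sat s l e (Ex \<phi>) \<longleftrightarrow> (\<exists>x<s ''n'' 0. sat s (Suc l) (e(l := x)) \<phi>)"

fun closed_below :: "nat \<Rightarrow> fm \<Rightarrow> bool" where
  "closed_below l (Edge i j) \<longleftrightarrow> i < l \<and> j < l"
| "closed_below l (In a i) \<longleftrightarrow> i < l"
| "closed_below l (Lt i j) \<longleftrightarrow> i < l \<and> j < l"
| "closed_below l (Neg \<phi>) \<longleftrightarrow> closed_below l \<phi>"
| "closed_below l (And \<phi> \<psi>) \<longleftrightarrow> closed_below l \<phi> \<and> closed_below l \<psi>"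
| "closed_below l (Ex \<phi>) \<longleftrightarrow> closed_below (Suc l) \<phi>"

fun arrays :: "fm \<Rightarrow> string set" where
  "arrays (Edge i j) = {}"
| "arrays (In a i) = {a}"
| "arrays (Lt i j) = {}"
| "arrays (Neg \<phi>) = arrays \<phi>"
| "arrays (And \<phi> \<psi>) = arrays \<phi> \<union> arrays \<psi>"
| "arrays (Ex \<phi>) = arrays \<phi>"

fun qdepth :: "fm \<Rightarrow> nat" where
  "qdepth (Neg \<phi>) = qdepth \<phi>"
| "qdepth (And \<phi> \<psi>) = max (qdepth \<phi>) (qdepth \<psi>)"
| "qdepth (Ex \<phi>) = Suc (qdepth \<phi>)"
| "qdepth _ = 0"

lemma sat_cong:
  assumes "closed_below l \<phi>" "\<And>a. a \<in> insert ''n'' (insert ''adj'' (arrays \<phi>)) \<Longrightarrow> s a = s' a"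
    and "\<And>i. i < l \<Longrightarrow> e i = e' i"
  shows "sat s l e \<phi> \<longleftrightarrow> sat s' l e' \<phi>"
  using assms
proof (induction \<phi> arbitrary: l e e')
  case (Neg \<phi>)
  have "sat s l e \<phi> \<longleftrightarrow> sat s' l e' \<phi>" by (rule Neg.IH) (use Neg.prems in auto)
  then show ?case by simp
next
  case (And \<phi> \<psi>)
  have "sat s l e \<phi> \<longleftrightarrow> sat s' l e' \<phi>" by (rule And.IH(1)) (use And.prems in auto)
  moreover have "sat s l e \<psi> \<longleftrightarrow> sat s' l e' \<psi>" by (rule And.IH(2)) (use And.prems in auto)
  ultimately show ?case by simp
next
  case (Ex \<phi>)
  have "sat s (Suc l) (e(l := x)) \<phi> \<longleftrightarrow> sat s' (Suc l) (e'(l := x)) \<phi>" for x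
    by (rule Ex.IH) (use Ex.prems in \<open>auto simp: less_Suc_eq\<close>)
  moreover have "s ''n'' = s' ''n''" using Ex.prems(2) by simp
  ultimately show ?case by simp
qed auto

abbreviation var :: "nat \<Rightarrow> expr" where "var i \<equiv> Get ''v'' (Const i)"
abbreviation size_reg :: expr where "size_reg \<equiv> Get ''n'' (Const 0)"
abbreviation res :: expr where "res \<equiv> Get ''r'' (Const 0)"

text \<open>In the loop for \<open>Ex\<close>, \<open>r[0]\<close> is 0 or 1, so the guard compares
  with n until a witness is found and with 0 afterwards: the product encodes the conjunction of
  being in range and having no witness yet.\<close>

fun decide :: "nat \<Rightarrow> fm \<Rightarrow> prog" where
  "decide l (Edge i j) = Put ''r'' (Const 0)
     (Less (Const 0) (Get ''adj'' (Add (Mul (var i) size_reg) (var j))))"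
| "decide l (In a i) = Put ''r'' (Const 0) (Less (Const 0) (Get a (var i)))"
| "decide l (Lt i j) = Put ''r'' (Const 0) (Less (var i) (var j))"
| "decide l (Neg \<phi>) = Seq (decide l \<phi>) (Put ''r'' (Const 0) (Sub (Const 1) res))"
| "decide l (And \<phi> \<psi>) = Seq (decide l \<phi>) (Cond res (decide l \<psi>) Skip)"
| "decide l (Ex \<phi>) =
     Seq (Put ''r'' (Const 0) (Const 0)) (Seq (Put ''v'' (Const l) (Const 0))
       (Loop (Less (var l) (Mul size_reg (Sub (Const 1) res)))
         (Seq (decide (Suc l) \<phi>) (Put ''v'' (Const l) (Add (var l) (Const 1))))))"

text \<open>15 covers the costliest atom, \<open>Edge\<close>, which takes 13. For
  \<open>Ex\<close>, each round spends 11 on the guard and 6 on the increment besides the body; the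
  final 17 are two assignments of cost 3 and the last guard.\<close>

fun decide_time :: "nat \<Rightarrow> fm \<Rightarrow> nat" where
  "decide_time n (Neg \<phi>) = decide_time n \<phi> + 6"
| "decide_time n (And \<phi> \<psi>) = decide_time n \<phi> + decide_time n \<psi> + 4"
| "decide_time n (Ex \<phi>) = n * (decide_time n \<phi> + 17) + 17"
| "decide_time n _ = 15"

text \<open>The cells of \<open>v\<close> from level \<open>l\<close> on are scratch space for the
  quantifiers yet to be entered. The bound \<open>m\<close> on all cells is carried along because
  \<open>fits\<close> has to be verified for every intermediate result.\<close>

definition frame :: "nat \<Rightarrow> nat \<Rightarrow> memory \<Rightarrow> memory \<Rightarrow> bool" where
  "frame m l s s' \<longleftrightarrow> (\<forall>a. a \<noteq> ''v'' \<longrightarrow> a \<noteq> ''r'' \<longrightarrow> s' a = s a) \<and>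
     (\<forall>i<l. s' ''v'' i = s ''v'' i) \<and> (\<forall>a x. s' a x \<le> m)"

lemma frameD:
  assumes "frame m l s s'"
  shows "a \<noteq> ''v'' \<Longrightarrow> a \<noteq> ''r'' \<Longrightarrow> s' a = s a" "i < l \<Longrightarrow> s' ''v'' i = s ''v'' i" "s' a x \<le> m"
  using assms by (simp_all add: frame_def)

lemma frame_trans: "frame m l s s' \<Longrightarrow> frame m l s' s'' \<Longrightarrow> frame m l s s''"
  by (simp add: frame_def)

lemma frame_mono: "frame m l s s' \<Longrightarrow> l' \<le> l \<Longrightarrow> frame m l' s s'"
  by (simp add: frame_def)

lemma frame_r: "(\<And>a x. s a x \<le> m) \<Longrightarrow> y \<le> m \<Longrightarrow> frame m l s (s(''r'' := (s ''r'')(x := y)))"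
  by (simp add: frame_def)

lemma frame_v:
  "(\<And>a x. s a x \<le> m) \<Longrightarrow> y \<le> m \<Longrightarrow> l \<le> i \<Longrightarrow> frame m l s (s(''v'' := (s ''v'')(i := y)))"
  by (auto simp: frame_def)

lemma sat_frame:
  assumes "frame m l' s s'" "closed_below l \<phi>" "''v'' \<notin> arrays \<phi>" "''r'' \<notin> arrays \<phi>"
    and "\<And>i. i < l \<Longrightarrow> e i = e' i"
  shows "sat s' l e \<phi> \<longleftrightarrow> sat s l e' \<phi>"
  by (rule sat_cong) (use assms in \<open>auto intro: frameD(1)\<close>)

lemma run_result:
  assumes "fits w f s" "eval_expr f s = of_bool P" "expr_cost f + 2 \<le> T" "1 \<le> m" "\<And>a x. s a x \<le> m"
  shows "\<exists>t s'. run w (Put ''r'' (Const 0) f) s t s' \<and> t \<le> T \<and> s' ''r'' 0 = of_bool P \<and> frame m l s s'"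
proof -
  have "run w (Put ''r'' (Const 0) f) s (expr_cost (Const 0) + expr_cost f + 1)
      (s(''r'' := (s ''r'')(eval_expr (Const 0) s := eval_expr f s)))"
    by (rule run_Put) (use assms(1) in simp_all)
  then have "run w (Put ''r'' (Const 0) f) s (expr_cost f + 2) (s(''r'' := (s ''r'')(0 := of_bool P)))"
    using assms(2) by simp
  moreover have "frame m l s (s(''r'' := (s ''r'')(0 := of_bool P)))"
    by (rule frame_r) (use assms in auto)
  moreover have "(s(''r'' := (s ''r'')(0 := of_bool P))) ''r'' 0 = of_bool P" by simp
  ultimately show ?thesis using assms(3) by blast
qed

text \<open>The term \<open>n * n + m\<close> covers the address of a matrix entry and any value
  read; \<open>l + qdepth \<phi>\<close> covers the variable numbers, which occur as constants in
  the program.\<close>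

lemma decide_run:
  assumes "closed_below l \<phi>" "''v'' \<notin> arrays \<phi>" "''r'' \<notin> arrays \<phi>"
    and "n \<le> m" "1 \<le> m" "n * n + m \<le> w" "l + qdepth \<phi> \<le> w"
    and "s ''n'' 0 = n" "\<And>a x. s a x \<le> m" "\<And>i. i < l \<Longrightarrow> s ''v'' i < n"
  shows "\<exists>t s'. run w (decide l \<phi>) s t s' \<and> t \<le> decide_time n \<phi> \<and>
    s' ''r'' 0 = of_bool (sat s l (s ''v'') \<phi>) \<and> frame m l s s'"
  using assms
proof (induction \<phi> arbitrary: l s)
  case (Edge i j)
  let ?f = "Less (Const 0) (Get ''adj'' (Add (Mul (var i) size_reg) (var j)))"
  have ij: "s ''v'' i < n" "s ''v'' j < n" using Edge by auto
  have "s ''v'' i * n \<le> n * n" using ij by simp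
  with ij have le: "s ''v'' i * n + s ''v'' j \<le> w" "s ''v'' i * n \<le> w" "s ''v'' i \<le> w" "s ''v'' j \<le> w" 
    using Edge.prems(4,6) by linarith+
  have "s a x \<le> w" for a x using Edge.prems(6) Edge.prems(9)[of a x] by linarith
  with le Edge.prems have "fits w ?f s" by simp
  then show ?case
    unfolding decide.simps by (rule run_result) (use Edge.prems in simp_all)
next
  case (In a i)
  let ?f = "Less (Const 0) (Get a (var i))"
  have "s a x \<le> w" for a x using In.prems(6) In.prems(9)[of a x] by linarith
  with In.prems have "fits w ?f s" by simp
  then show ?case
    unfolding decide.simps by (rule run_result) (use In.prems in simp_all)
next
  case (Lt i j)
  let ?f = "Less (var i) (var j)"
  have "s a x \<le> w" for a x using Lt.prems(6) Lt.prems(9)[of a x] by linarith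
  with Lt.prems have "fits w ?f s" by simp
  then show ?case
    unfolding decide.simps by (rule run_result) (use Lt.prems in simp_all)
next
  case (Neg \<phi>)
  have "\<exists>t s'. run w (decide l \<phi>) s t s' \<and> t \<le> decide_time n \<phi> \<and>
      s' ''r'' 0 = of_bool (sat s l (s ''v'') \<phi>) \<and> frame m l s s'"
    by (rule Neg.IH) (use Neg.prems in auto)
  then obtain t s' where s': "run w (decide l \<phi>) s t s'" "t \<le> decide_time n \<phi>"
      "s' ''r'' 0 = of_bool (sat s l (s ''v'') \<phi>)" "frame m l s s'" by blast
  let ?f = "Sub (Const 1) res"
  have w: "1 \<le> w" using Neg.prems(5,6) by linarith
  with s'(3) have f: "fits w ?f s'" by simp
  have "\<exists>t s''. run w (Put ''r'' (Const 0) ?f) s' t s'' \<and> t \<le> 6 \<and>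
      s'' ''r'' 0 = of_bool (sat s l (s ''v'') (Neg \<phi>)) \<and> frame m l s' s''"
    by (rule run_result[OF f]) (use s' Neg.prems in \<open>auto intro: frameD(3)\<close>)
  then obtain t' s'' where s'': "run w (Put ''r'' (Const 0) ?f) s' t' s''" "t' \<le> 6"
      "s'' ''r'' 0 = of_bool (sat s l (s ''v'') (Neg \<phi>))" "frame m l s' s''" by blast
  show ?case
    unfolding decide.simps
    by (intro exI conjI, rule run_Seq[OF s'(1) s''(1)],
        use s'(2) s''(2) in simp, rule s''(3), rule frame_trans[OF s'(4) s''(4)])
next
  case (And \<phi> \<psi>)
  have "\<exists>t s'. run w (decide l \<phi>) s t s' \<and> t \<le> decide_time n \<phi> \<and>
      s' ''r'' 0 = of_bool (sat s l (s ''v'') \<phi>) \<and> frame m l s s'"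
    by (rule And.IH(1)) (use And.prems in auto)
  then obtain t s' where s': "run w (decide l \<phi>) s t s'" "t \<le> decide_time n \<phi>"
      "s' ''r'' 0 = of_bool (sat s l (s ''v'') \<phi>)" "frame m l s s'" by blast
  have w: "1 \<le> w" using And.prems(5,6) by linarith
  with s'(3) have f: "fits w res s'" by simp
  show ?case
  proof (cases "sat s l (s ''v'') \<phi>")
    case True
    have "\<exists>t s''. run w (decide l \<psi>) s' t s'' \<and> t \<le> decide_time n \<psi> \<and>
        s'' ''r'' 0 = of_bool (sat s' l (s' ''v'') \<psi>) \<and> frame m l s' s''"
      by (rule And.IH(2)) (use And.prems frameD[OF s'(4)] in auto)
    then obtain t' s'' where s'': "run w (decide l \<psi>) s' t' s''" "t' \<le> decide_time n \<psi>"
        "s'' ''r'' 0 = of_bool (sat s' l (s' ''v'') \<psi>)" "frame m l s' s''" by blast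
    have "sat s' l (s' ''v'') \<psi> \<longleftrightarrow> sat s l (s ''v'') \<psi>"
      by (rule sat_frame[OF s'(4)]) (use And.prems frameD[OF s'(4)] in auto)
    moreover have "eval_expr res s' \<noteq> 0" using True s'(3) by simp
    ultimately show ?thesis
      using run_Seq[OF s'(1) run_Cond_true[OF f _ s''(1)], of Skip] True s'(2) s''(2,3)
        frame_trans[OF s'(4) s''(4)]
      by (intro exI[of _ "t + (expr_cost res + 1 + t')"] exI[of _ s'']) simp
  next
    case False
    then have "eval_expr res s' = 0" using s'(3) by simp
    with False show ?thesis
      using run_Seq[OF s'(1) run_Cond_false[OF f _ run_Skip], of "decide l \<psi>"] s'
      by (intro exI[of _ "t + (expr_cost res + 1 + 1)"] exI[of _ s']) simp
  qed
next
  case (Ex \<phi>)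
  let ?c = "Less (var l) (Mul size_reg (Sub (Const 1) res))"
  let ?inc = "Put ''v'' (Const l) (Add (var l) (Const 1))"
  let ?body = "Seq (decide (Suc l) \<phi>) ?inc"
  have w: "m \<le> w" "1 \<le> w" "l \<le> w" using Ex.prems(5-7) by auto
  \<comment> \<open>Induction on the number \<open>k\<close> of values still to be tried, entered
    with \<open>r[0] = 0\<close>; the result concerns only witnesses from \<open>i\<close>
    on.\<close>
  have loop: "\<exists>t s'. run w (Loop ?c ?body) s t s' \<and> t \<le> k * (decide_time n \<phi> + 17) + 11 \<and>
      s' ''r'' 0 = of_bool (\<exists>x<n. i \<le> x \<and> sat s (Suc l) ((s ''v'')(l := x)) \<phi>) \<and> frame m l s s'"
    if "n = i + k" "s ''v'' l = i" "s ''r'' 0 = 0" "s ''n'' 0 = n" "\<And>a x. s a x \<le> m"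
      "\<And>j. j < l \<Longrightarrow> s ''v'' j < n" for i k s
    using that
  proof (induction k arbitrary: i s)
    case 0
    have sw: "s a x \<le> w" for a x using 0(5)[of a x] w by linarith
    have halt: "run w (Loop ?c ?body) s (expr_cost ?c + 1) s"
      by (rule run_Loop_false) (use 0 w sw[of "''n''" 0] in auto)
    show ?case
      by (intro exI conjI, rule halt) (use 0 in \<open>auto simp: frame_def\<close>)
  next
    case (Suc k)
    have sw: "s a x \<le> w" for a x using Suc(6)[of a x] w by linarith
    have c: "fits w ?c s" "eval_expr ?c s \<noteq> 0"
      using Suc.prems w sw[of "''n''" 0] sw[of "''v''" l] by auto
    have "\<exists>t s'. run w (decide (Suc l) \<phi>) s t s' \<and> t \<le> decide_time n \<phi> \<and>
        s' ''r'' 0 = of_bool (sat s (Suc l) (s ''v'') \<phi>) \<and> frame m (Suc l) s s'"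
      by (rule Ex.IH) (use Suc.prems Ex.prems in \<open>auto simp: less_Suc_eq\<close>)
    then obtain t s1 where s1: "run w (decide (Suc l) \<phi>) s t s1" "t \<le> decide_time n \<phi>"
        "s1 ''r'' 0 = of_bool (sat s (Suc l) (s ''v'') \<phi>)" "frame m (Suc l) s s1" by blast
    have s1l: "s1 ''v'' l = i" using frameD(2)[OF s1(4), of l] Suc.prems by simp
    define s2 where "s2 = s1(''v'' := (s1 ''v'')(l := Suc i))"
    have "fits w (Add (var l) (Const 1)) s1"
      using s1l Suc.prems(1) Ex.prems(4) w by simp
    then have "run w ?inc s1 (expr_cost (Const l) + expr_cost (Add (var l) (Const 1)) + 1)
        (s1(''v'' := (s1 ''v'')(eval_expr (Const l) s1 := eval_expr (Add (var l) (Const 1)) s1)))"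
      by (intro run_Put) (use w in auto)
    then have inc: "run w ?inc s1 6 s2" by (simp add: s2_def s1l eval_nat_numeral)
    have f12: "frame m l s1 s2"
      unfolding s2_def by (rule frame_v) (use frameD(3)[OF s1(4)] Suc.prems(1) Ex.prems(4) in auto)
    have f2: "frame m l s s2"
      by (rule frame_trans[OF frame_mono[OF s1(4)] f12]) simp
    have i: "i < n" using Suc.prems(1) by simp
    have upd: "(s ''v'')(l := i) = s ''v''" using Suc.prems(2) by auto
    have r2: "s2 ''r'' 0 = of_bool (sat s (Suc l) (s ''v'') \<phi>)" by (simp add: s2_def s1(3))
    show ?case
    proof (cases "sat s (Suc l) (s ''v'') \<phi>")
      case True
      \<comment> \<open>Now the guard compares with 0 and fails, so the witness \<open>i\<close>
        ends the loop after one further test.\<close>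
      with r2 have r2: "s2 ''r'' 0 = 1" by simp
      have s2w: "s2 a x \<le> w" for a x using frameD(3)[OF f2, of a x] w by linarith
      have "run w (Loop ?c ?body) s2 (expr_cost ?c + 1) s2"
        by (rule run_Loop_false) (use r2 w s2w[of "''n''" 0] s2w[of "''v''" l] in auto)
      note halt = run_Loop_true[OF c run_Seq[OF s1(1) inc] this]
      have "\<exists>x<n. i \<le> x \<and> sat s (Suc l) ((s ''v'')(l := x)) \<phi>"
        by (rule exI[of _ i]) (use True i upd in simp)
      then have r2': "s2 ''r'' 0 = of_bool (\<exists>x<n. i \<le> x \<and> sat s (Suc l) ((s ''v'')(l := x)) \<phi>)"
        using r2 by simp
      show ?thesis
        by (intro exI conjI, rule halt, use s1(2) in simp, rule r2', rule f2)
    next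
      case False
      have "\<exists>t s'. run w (Loop ?c ?body) s2 t s' \<and> t \<le> k * (decide_time n \<phi> + 17) + 11 \<and>
          s' ''r'' 0 = of_bool (\<exists>x<n. Suc i \<le> x \<and> sat s2 (Suc l) ((s2 ''v'')(l := x)) \<phi>) \<and> frame m l s2 s'"
        by (rule Suc.IH) (use False r2 Suc.prems frameD[OF f2] in \<open>auto simp: s2_def\<close>)
      then obtain t' s3 where s3: "run w (Loop ?c ?body) s2 t' s3" "t' \<le> k * (decide_time n \<phi> + 17) + 11"
          "s3 ''r'' 0 = of_bool (\<exists>x<n. Suc i \<le> x \<and> sat s2 (Suc l) ((s2 ''v'')(l := x)) \<phi>)"
          "frame m l s2 s3" by blast
      have "sat s2 (Suc l) ((s2 ''v'')(l := x)) \<phi> \<longleftrightarrow> sat s (Suc l) ((s ''v'')(l := x)) \<phi>" for x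
        by (rule sat_frame[OF f2]) (use Ex.prems frameD[OF f2] in \<open>auto simp: less_Suc_eq\<close>)
      moreover have "(\<exists>x<n. Suc i \<le> x \<and> P x) \<longleftrightarrow> (\<exists>x<n. i \<le> x \<and> P x)" if "\<not> P i" for P
        using that by (metis Suc_le_eq le_neq_implies_less less_imp_le_nat)
      ultimately have r3: "s3 ''r'' 0 = of_bool (\<exists>x<n. i \<le> x \<and> sat s (Suc l) ((s ''v'')(l := x)) \<phi>)"
        using s3(3) False upd by simp
      show ?thesis
        by (intro exI conjI, rule run_Loop_true[OF c run_Seq[OF s1(1) inc] s3(1)],
            use s1(2) s3(2) in simp, rule r3, rule frame_trans[OF f2 s3(4)])
    qed
  qed
  define s1 where "s1 = s(''r'' := (s ''r'')(0 := 0))"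
  define s2 where "s2 = s1(''v'' := (s1 ''v'')(l := 0))"
  have p1: "run w (Put ''r'' (Const 0) (Const 0)) s 3 s1"
    using run_Put[of w "Const 0" s "Const 0" "''r''"] by (simp add: s1_def eval_nat_numeral)
  have p2: "run w (Put ''v'' (Const l) (Const 0)) s1 3 s2"
    using run_Put[of w "Const l" s1 "Const 0" "''v''"] w by (simp add: s2_def eval_nat_numeral)
  have f1: "frame m l s s1" unfolding s1_def by (rule frame_r) (use Ex.prems in auto)
  have f12: "frame m l s1 s2" unfolding s2_def by (rule frame_v) (use frameD(3)[OF f1] in auto)
  note f2 = frame_trans[OF f1 f12]
  have "\<exists>t s'. run w (Loop ?c ?body) s2 t s' \<and> t \<le> n * (decide_time n \<phi> + 17) + 11 \<and>
      s' ''r'' 0 = of_bool (\<exists>x<n. 0 \<le> x \<and> sat s2 (Suc l) ((s2 ''v'')(l := x)) \<phi>) \<and> frame m l s2 s'"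
    by (rule loop) (use Ex.prems frameD[OF f2] in \<open>auto simp: s1_def s2_def\<close>)
  then obtain t s3 where s3: "run w (Loop ?c ?body) s2 t s3" "t \<le> n * (decide_time n \<phi> + 17) + 11"
      "s3 ''r'' 0 = of_bool (\<exists>x<n. 0 \<le> x \<and> sat s2 (Suc l) ((s2 ''v'')(l := x)) \<phi>)" "frame m l s2 s3"
    by blast
  have "sat s2 (Suc l) ((s2 ''v'')(l := x)) \<phi> \<longleftrightarrow> sat s (Suc l) ((s ''v'')(l := x)) \<phi>" for x
    by (rule sat_frame[OF f2]) (use Ex.prems frameD[OF f2] in \<open>auto simp: less_Suc_eq\<close>)
  with s3(3) Ex.prems(8) have r3: "s3 ''r'' 0 = of_bool (sat s l (s ''v'') (Ex \<phi>))" by simp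
  show ?case
    unfolding decide.simps
    by (intro exI conjI, rule run_Seq[OF p1 run_Seq[OF p2 s3(1)]],
        use s3(2) in simp, rule r3, rule frame_trans[OF f2 s3(4)])
qed

text \<open>The coefficient of \<open>Suc n ^ d\<close> in the time bound; 34 collects the two 17s
  of \<open>decide_time\<close>. Powers of \<open>Suc n\<close> are at least 1 even for
  \<open>n = 0\<close> and so absorb additive constants.\<close>

fun time_factor :: "fm \<Rightarrow> nat" where
  "time_factor (Neg \<phi>) = time_factor \<phi> + 6"
| "time_factor (And \<phi> \<psi>) = time_factor \<phi> + time_factor \<psi> + 4"
| "time_factor (Ex \<phi>) = time_factor \<phi> + 34"
| "time_factor _ = 15"

lemma decide_time_le: "qdepth \<phi> \<le> d \<Longrightarrow> decide_time n \<phi> \<le> time_factor \<phi> * Suc n ^ d"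
proof (induction \<phi> arbitrary: d)
  case (Neg \<phi>)
  then show ?case
    unfolding decide_time.simps time_factor.simps add_mult_distrib by (intro add_le_mono) simp_all
next
  case (And \<phi> \<psi>)
  then show ?case
    unfolding decide_time.simps time_factor.simps add_mult_distrib by (intro add_le_mono) simp_all
next
  case (Ex \<phi>)
  then obtain d' where d: "d = Suc d'" "qdepth \<phi> \<le> d'" by (cases d) auto
  have "decide_time n \<phi> + 17 \<le> (time_factor \<phi> + 17) * Suc n ^ d'"
    unfolding add_mult_distrib by (intro add_le_mono Ex.IH d) simp
  then have "n * (decide_time n \<phi> + 17) \<le> n * ((time_factor \<phi> + 17) * Suc n ^ d')"
    by (rule mult_le_mono2)
  also have "\<dots> \<le> Suc n * ((time_factor \<phi> + 17) * Suc n ^ d')" by (rule mult_le_mono1) simp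
  also have "\<dots> = (time_factor \<phi> + 17) * Suc n ^ d" by (simp only: d power_Suc mult_ac)
  finally have *: "n * (decide_time n \<phi> + 17) \<le> (time_factor \<phi> + 17) * Suc n ^ d" .
  have "17 \<le> 17 * Suc n ^ d" by simp
  from add_le_mono[OF * this] show ?case
    by (simp add: add_mult_distrib)
qed simp_all

section \<open>Updating arrays vertex by vertex\<close>

text \<open>A layer \<open>(a, k, \<phi>)\<close> adds \<open>k\<close> to \<open>a[x]\<close> for all vertices \<open>x\<close> that satisfy \<open>\<phi>\<close>.\<close>

type_synonym layer = "string \<times> nat \<times> fm"

fun layer_prog :: "layer \<Rightarrow> prog" where
  "layer_prog (a, k, \<phi>) = Seq (Put ''v'' (Const 0) (Const 0)) (Loop (Less (var 0) size_reg)
     (Seq (decide 1 \<phi>) (Seq (Put a (var 0) (Add (Get a (var 0)) (Mul (Const k) res)))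
       (Put ''v'' (Const 0) (Add (var 0) (Const 1))))))"

fun apply_layer :: "memory \<Rightarrow> layer \<Rightarrow> memory" where
  "apply_layer s (a, k, \<phi>) =
     s(a := \<lambda>x. s a x + (if x < s ''n'' 0 \<and> sat s 1 (\<lambda>_. x) \<phi> then k else 0))"

text \<open>Per vertex, 23 consists of 6 for the guard, 11 for the addition and 6 for the increment;
  9 is the initial assignment and the last guard.\<close>

fun layer_time :: "nat \<Rightarrow> layer \<Rightarrow> nat" where
  "layer_time n (a, k, \<phi>) = n * (decide_time n \<phi> + 23) + 9"

text \<open>As the formula does not read \<open>a\<close>, updates already made cannot influence
  later tests, and the in-place loop agrees with the simultaneous update of
  \<open>apply_layer\<close>.\<close>

fun proper_layer :: "layer \<Rightarrow> bool" where
  "proper_layer (a, k, \<phi>) \<longleftrightarrow> closed_below 1 \<phi> \<and> a \<notin> {''v'', ''r'', ''n'', ''adj''} \<and>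
     arrays \<phi> \<inter> {''v'', ''r'', a} = {}"

text \<open>The working arrays \<open>v\<close> and \<open>r\<close> are left out, since
  \<open>apply_layer\<close> does not track them.\<close>

definition same_data :: "memory \<Rightarrow> memory \<Rightarrow> bool" where
  "same_data s s' \<longleftrightarrow> (\<forall>a. a \<noteq> ''v'' \<longrightarrow> a \<noteq> ''r'' \<longrightarrow> s' a = s a)"

text \<open>Each cell of \<open>a\<close> is increased at most once, so the bound on values grows
  from \<open>m\<close> to \<open>m + k\<close>. The loop invariant therefore keeps the bound
  \<open>m\<close> for the cells of \<open>a\<close> not yet visited.\<close>

lemma layer_run:
  assumes proper: "proper_layer (a, k, \<phi>)"
    and m: "n \<le> m" "1 \<le> m" "n * n + m + k \<le> w" "1 + qdepth \<phi> \<le> w"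
    and s: "s ''n'' 0 = n" "\<And>b x. s b x \<le> m"
  shows "\<exists>t s'. run w (layer_prog (a, k, \<phi>)) s t s' \<and> t \<le> layer_time n (a, k, \<phi>) \<and>
    same_data (apply_layer s (a, k, \<phi>)) s' \<and> (\<forall>b x. s' b x \<le> m + k)"
proof -
  have closed: "closed_below 1 \<phi>" and a: "a \<noteq> ''v''" "a \<noteq> ''r''" "a \<noteq> ''n''" "a \<noteq> ''adj''"
    and arr: "''v'' \<notin> arrays \<phi>" "''r'' \<notin> arrays \<phi>" "a \<notin> arrays \<phi>"
    using proper by auto
  let ?c = "Less (var 0) size_reg"
  let ?add = "Put a (var 0) (Add (Get a (var 0)) (Mul (Const k) res))"
  let ?inc = "Put ''v'' (Const 0) (Add (var 0) (Const 1))"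
  let ?body = "Seq (decide 1 \<phi>) (Seq ?add ?inc)"
  have w: "m + k \<le> w" "1 \<le> w" using m by auto
  have loop: "\<exists>t s'. run w (Loop ?c ?body) s t s' \<and> t \<le> j * (decide_time n \<phi> + 23) + 6 \<and>
      (\<forall>b. b \<noteq> ''v'' \<longrightarrow> b \<noteq> ''r'' \<longrightarrow> b \<noteq> a \<longrightarrow> s' b = s b) \<and>
      (\<forall>x. s' a x = s a x + (if i \<le> x \<and> x < n \<and> sat s 1 (\<lambda>_. x) \<phi> then k else 0)) \<and>
      (\<forall>b x. s' b x \<le> m + k)"
    if "n = i + j" "s ''v'' 0 = i" "s ''n'' 0 = n" "\<And>b x. s b x \<le> m + k" "\<And>x. i \<le> x \<Longrightarrow> s a x \<le> m"
    for i j s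
    using that
  proof (induction j arbitrary: i s)
    case 0
    have sw: "s b x \<le> w" for b x using 0(4)[of b x] w by linarith
    have halt: "run w (Loop ?c ?body) s (expr_cost ?c + 1) s"
      by (rule run_Loop_false) (use 0 w sw[of "''n''" 0] in auto)
    show ?case
      by (intro exI conjI, rule halt) (use 0 in auto)
  next
    case (Suc j)
    have sw: "s b x \<le> w" for b x using Suc(5)[of b x] w by linarith
    have i: "i < n" using Suc.prems(1) by simp
    have c: "fits w ?c s" "eval_expr ?c s \<noteq> 0"
      using Suc.prems w sw[of "''n''" 0] sw[of "''v''" 0] by auto
    have "\<exists>t s'. run w (decide 1 \<phi>) s t s' \<and> t \<le> decide_time n \<phi> \<and>
        s' ''r'' 0 = of_bool (sat s 1 (s ''v'') \<phi>) \<and> frame (m + k) 1 s s'"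
      by (rule decide_run[OF closed arr(1,2)]) (use Suc.prems m i in auto)
    then obtain t s1 where s1: "run w (decide 1 \<phi>) s t s1" "t \<le> decide_time n \<phi>"
        "s1 ''r'' 0 = of_bool (sat s 1 (s ''v'') \<phi>)" "frame (m + k) 1 s s1" by blast
    have s1v: "s1 ''v'' 0 = i" using frameD(2)[OF s1(4), of 0] Suc.prems by simp
    have s1a: "s1 a = s a" using frameD(1)[OF s1(4)] a by simp
    have "sat s 1 (s ''v'') \<phi> \<longleftrightarrow> sat s 1 (\<lambda>_. i) \<phi>"
      by (rule sat_cong[OF closed]) (use Suc.prems in auto)
    with s1(3) have s1r: "s1 ''r'' 0 = of_bool (sat s 1 (\<lambda>_. i) \<phi>)" by simp
    define y where "y = s a i + k * of_bool (sat s 1 (\<lambda>_. i) \<phi>)"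
    have y: "y \<le> m + k" using Suc.prems(5)[of i] by (simp add: y_def)
    define s2 where "s2 = s1(a := (s1 a)(i := y))"
    define s3 where "s3 = s2(''v'' := (s2 ''v'')(0 := Suc i))"
    have iw: "i \<le> w" "Suc i \<le> w" using i m by auto
    have saw: "s a i \<le> w" by (rule sw)
    have fits_add: "fits w (var 0) s1" "fits w (Add (Get a (var 0)) (Mul (Const k) res)) s1"
      using s1v s1a s1r iw y w saw by (auto simp: y_def)
    have "run w ?add s1 11 s2"
      using run_Put[OF fits_add, of a] s1v s1a s1r by (simp add: s2_def y_def eval_nat_numeral)
    moreover have s2v: "s2 ''v'' 0 = i" using s1v a by (simp add: s2_def)
    have "run w ?inc s2 6 s3"
      using run_Put[of w "Const 0" s2 "Add (var 0) (Const 1)" "''v''"] s2v iw w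
      by (simp add: s3_def eval_nat_numeral)
    ultimately have body: "run w ?body s (t + (11 + 6)) s3"
      by (intro run_Seq[OF s1(1)] run_Seq)
    have s3b: "s3 b = s b" if "b \<noteq> ''v''" "b \<noteq> ''r''" "b \<noteq> a" for b
      using that frameD(1)[OF s1(4)] by (simp add: s3_def s2_def)
    have s3a: "s3 a = (s a)(i := y)" using a s1a by (simp add: s3_def s2_def)
    have s3m: "s3 b x \<le> m + k" for b x
      using frameD(3)[OF s1(4), of b x] y i m by (auto simp: s3_def s2_def)
    have "\<exists>t s'. run w (Loop ?c ?body) s3 t s' \<and> t \<le> j * (decide_time n \<phi> + 23) + 6 \<and>
        (\<forall>b. b \<noteq> ''v'' \<longrightarrow> b \<noteq> ''r'' \<longrightarrow> b \<noteq> a \<longrightarrow> s' b = s3 b) \<and>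
        (\<forall>x. s' a x = s3 a x + (if Suc i \<le> x \<and> x < n \<and> sat s3 1 (\<lambda>_. x) \<phi> then k else 0)) \<and>
        (\<forall>b x. s' b x \<le> m + k)"
      by (rule Suc.IH) (use Suc.prems s3b s3a s3m a in \<open>auto simp: s3_def\<close>)
    then obtain t' s4 where s4: "run w (Loop ?c ?body) s3 t' s4" "t' \<le> j * (decide_time n \<phi> + 23) + 6"
        "\<And>b. b \<noteq> ''v'' \<Longrightarrow> b \<noteq> ''r'' \<Longrightarrow> b \<noteq> a \<Longrightarrow> s4 b = s3 b"
        "\<And>x. s4 a x = s3 a x + (if Suc i \<le> x \<and> x < n \<and> sat s3 1 (\<lambda>_. x) \<phi> then k else 0)"
        "\<And>b x. s4 b x \<le> m + k" by blast
    have sat3: "sat s3 1 (\<lambda>_. x) \<phi> \<longleftrightarrow> sat s 1 (\<lambda>_. x) \<phi>" for x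
    proof (rule sat_cong[OF closed])
      fix b assume "b \<in> insert ''n'' (insert ''adj'' (arrays \<phi>))"
      then have "b \<noteq> ''v''" "b \<noteq> ''r''" "b \<noteq> a" using arr a by auto
      then show "s3 b = s b" by (rule s3b)
    qed simp
    have a4: "s4 a x = s a x + (if i \<le> x \<and> x < n \<and> sat s 1 (\<lambda>_. x) \<phi> then k else 0)" for x
      using s4(4)[of x] i unfolding sat3 s3a y_def by auto
    show ?case
      by (intro exI conjI, rule run_Loop_true[OF c body s4(1)])
        (use a4 s1(2) s4(2,3,5) s3b in simp_all)
  qed
  define s1 where "s1 = s(''v'' := (s ''v'')(0 := 0))"
  have p1: "run w (Put ''v'' (Const 0) (Const 0)) s 3 s1"
    using run_Put[of w "Const 0" s "Const 0" "''v''"] by (simp add: s1_def eval_nat_numeral)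
  have "\<exists>t s'. run w (Loop ?c ?body) s1 t s' \<and> t \<le> n * (decide_time n \<phi> + 23) + 6 \<and>
      (\<forall>b. b \<noteq> ''v'' \<longrightarrow> b \<noteq> ''r'' \<longrightarrow> b \<noteq> a \<longrightarrow> s' b = s1 b) \<and>
      (\<forall>x. s' a x = s1 a x + (if 0 \<le> x \<and> x < n \<and> sat s1 1 (\<lambda>_. x) \<phi> then k else 0)) \<and>
      (\<forall>b x. s' b x \<le> m + k)"
    by (rule loop) (use s a in \<open>auto simp: s1_def intro: le_trans[OF _ le_add1]\<close>)
  then obtain t s2 where s2: "run w (Loop ?c ?body) s1 t s2" "t \<le> n * (decide_time n \<phi> + 23) + 6"
      "\<And>b. b \<noteq> ''v'' \<Longrightarrow> b \<noteq> ''r'' \<Longrightarrow> b \<noteq> a \<Longrightarrow> s2 b = s1 b"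
      "\<And>x. s2 a x = s1 a x + (if 0 \<le> x \<and> x < n \<and> sat s1 1 (\<lambda>_. x) \<phi> then k else 0)"
      "\<And>b x. s2 b x \<le> m + k" by blast
  have sat1: "sat s1 1 (\<lambda>_. x) \<phi> \<longleftrightarrow> sat s 1 (\<lambda>_. x) \<phi>" for x
    by (rule sat_cong[OF closed]) (use arr in \<open>auto simp: s1_def\<close>)
  have "same_data (apply_layer s (a, k, \<phi>)) s2"
    unfolding same_data_def
  proof (intro allI impI)
    fix b assume b: "b \<noteq> ''v''" "b \<noteq> ''r''"
    show "s2 b = apply_layer s (a, k, \<phi>) b"
    proof (cases "b = a")
      case True
      have "s2 a x = apply_layer s (a, k, \<phi>) a x" for x
        using s2(4)[of x] a s(1) unfolding sat1 by (simp add: s1_def)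
      with True show ?thesis by blast
    next
      case False
      with b s2(3)[OF b False] show ?thesis by (simp add: s1_def)
    qed
  qed
  moreover have "3 + t \<le> layer_time n (a, k, \<phi>)" using s2(2) by simp
  moreover have "run w (layer_prog (a, k, \<phi>)) s (3 + t) s2"
    using run_Seq[OF p1 s2(1)] by simp
  ultimately show ?thesis using s2(5) by blast
qed

fun layers_prog :: "layer list \<Rightarrow> prog" where
  "layers_prog [] = Skip"
| "layers_prog (L # Ls) = Seq (layer_prog L) (layers_prog Ls)"

lemma same_data_apply_layer:
  assumes same: "same_data s s'" and "proper_layer L"
  shows "same_data (apply_layer s L) (apply_layer s' L)"
proof (cases L)
  case (fields a k \<phi>)
  with assms(2) have closed: "closed_below 1 \<phi>" and a: "a \<noteq> ''v''" "a \<noteq> ''r''"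
    and arr: "''v'' \<notin> arrays \<phi>" "''r'' \<notin> arrays \<phi>" by simp_all
  have eq: "s' b = s b" if "b \<noteq> ''v''" "b \<noteq> ''r''" for b
    using same that by (simp add: same_data_def)
  have "sat s' 1 (\<lambda>_. x) \<phi> \<longleftrightarrow> sat s 1 (\<lambda>_. x) \<phi>" for x
  proof (rule sat_cong[OF closed])
    fix b assume "b \<in> insert ''n'' (insert ''adj'' (arrays \<phi>))"
    then have "b \<noteq> ''v''" "b \<noteq> ''r''" using arr by auto
    then show "s' b = s b" by (rule eq)
  qed simp
  then show ?thesis
    unfolding same_data_def fields apply_layer.simps using eq a by simp
qed

lemma same_data_foldl:
  assumes "same_data s s'" "\<forall>L\<in>set Ls. proper_layer L"
  shows "same_data (foldl apply_layer s Ls) (foldl apply_layer s' Ls)"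
  using assms
proof (induction Ls arbitrary: s s')
  case (Cons L Ls)
  have "same_data (apply_layer s L) (apply_layer s' L)"
    by (rule same_data_apply_layer) (use Cons.prems in simp_all)
  from Cons.IH[OF this] Cons.prems show ?case by simp
qed simp

text \<open>The sum of all increments bounds the growth of the cells. A run agrees with
  \<open>apply_layer\<close> only up to the working arrays, and \<open>same_data_foldl\<close>
  carries this agreement through the remaining layers.\<close>

lemma layers_run:
  assumes "\<forall>L\<in>set Ls. proper_layer L \<and> qdepth (snd (snd L)) \<le> d"
    and "n \<le> m" "1 \<le> m" "n * n + m + (\<Sum>L\<leftarrow>Ls. fst (snd L)) \<le> w" "1 + d \<le> w"
    and "s ''n'' 0 = n" "\<And>b x. s b x \<le> m"
  shows "\<exists>t s'. run w (layers_prog Ls) s t s' \<and> t \<le> (\<Sum>L\<leftarrow>Ls. layer_time n L) + 1 \<and>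
    same_data (foldl apply_layer s Ls) s'"
  using assms
proof (induction Ls arbitrary: s m)
  case Nil
  show ?case
    by (intro exI conjI, simp only: layers_prog.simps, rule run_Skip) (simp_all add: same_data_def)
next
  case (Cons L Ls)
  obtain a k \<phi> where L: "L = (a, k, \<phi>)" by (cases L)
  have "\<exists>t s'. run w (layer_prog (a, k, \<phi>)) s t s' \<and> t \<le> layer_time n (a, k, \<phi>) \<and>
      same_data (apply_layer s (a, k, \<phi>)) s' \<and> (\<forall>b x. s' b x \<le> m + k)"
    by (rule layer_run) (use Cons.prems L in auto)
  then have "\<exists>t s'. run w (layer_prog L) s t s' \<and> t \<le> layer_time n L \<and>
      same_data (apply_layer s L) s' \<and> (\<forall>b x. s' b x \<le> m + k)"
    unfolding L .
  then obtain t s1 where s1: "run w (layer_prog L) s t s1" "t \<le> layer_time n L"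
      "same_data (apply_layer s L) s1" "\<And>b x. s1 b x \<le> m + k"
    by (elim exE conjE) blast
  have "''n'' \<noteq> a" using Cons.prems(1) L by auto
  then have "apply_layer s L ''n'' = s ''n''" by (simp add: L)
  with s1(3) Cons.prems(6) have n1: "s1 ''n'' 0 = n" by (simp add: same_data_def)
  have "\<exists>t s'. run w (layers_prog Ls) s1 t s' \<and> t \<le> (\<Sum>L\<leftarrow>Ls. layer_time n L) + 1 \<and>
      same_data (foldl apply_layer s1 Ls) s'"
    by (rule Cons.IH[of "m + k"]) (use Cons.prems(1-5) L s1(4) n1 in simp_all)
  then obtain t' s2 where s2: "run w (layers_prog Ls) s1 t' s2" "t' \<le> (\<Sum>L\<leftarrow>Ls. layer_time n L) + 1"
      "same_data (foldl apply_layer s1 Ls) s2" by blast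
  have "same_data (foldl apply_layer (apply_layer s L) Ls) (foldl apply_layer s1 Ls)"
    by (rule same_data_foldl[OF s1(3)]) (use Cons.prems(1) in simp)
  with s2(3) have "same_data (foldl apply_layer s (L # Ls)) s2" by (simp add: same_data_def)
  moreover have "run w (layers_prog (L # Ls)) s (t + t') s2"
    using run_Seq[OF s1(1) s2(1)] by simp
  moreover have "t + t' \<le> (\<Sum>L\<leftarrow>L # Ls. layer_time n L) + 1" using s1(2) s2(2) by simp
  ultimately show ?case by blast
qed

lemma layer_time_le:
  assumes "qdepth \<phi> \<le> d"
  shows "layer_time n (a, k, \<phi>) \<le> (time_factor \<phi> + 32) * Suc n ^ Suc d"
proof -
  have "decide_time n \<phi> + 23 \<le> (time_factor \<phi> + 23) * Suc n ^ d"
    unfolding add_mult_distrib by (intro add_le_mono decide_time_le assms) simp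
  then have "n * (decide_time n \<phi> + 23) \<le> Suc n * ((time_factor \<phi> + 23) * Suc n ^ d)"
    by (intro mult_le_mono) simp_all
  also have "\<dots> = (time_factor \<phi> + 23) * Suc n ^ Suc d" by (simp only: power_Suc mult_ac)
  finally have "n * (decide_time n \<phi> + 23) + 9 \<le> (time_factor \<phi> + 23) * Suc n ^ Suc d + 9 * Suc n ^ Suc d"
    by (intro add_le_mono) (simp_all del: power_Suc)
  also have "\<dots> = (time_factor \<phi> + 32) * Suc n ^ Suc d"
    unfolding add_mult_distrib[symmetric] by simp
  finally show ?thesis by simp
qed

text \<open>One factor \<open>n\<close> stems from the loop over the vertices and one from each of
  at most \<open>d\<close> nested quantifiers.\<close>

lemma layers_computable:
  assumes layers: "\<forall>L\<in>set Ls. proper_layer L \<and> qdepth (snd (snd L)) \<le> d"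
    and correct: "\<And>G n s. n \<ge> 1 \<Longrightarrow> verts G = {0..<n} \<Longrightarrow> simple_graph G \<Longrightarrow> P G \<Longrightarrow>
      same_data (foldl apply_layer (input_memory G) Ls) s \<Longrightarrow> Q G s"
  shows "computable_in_time (\<lambda>n. real n ^ Suc d) P Q"
proof -
  define K where "K = (\<Sum>L\<leftarrow>Ls. time_factor (snd (snd L)) + 32) + 1"
  define k where "k = (\<Sum>L\<leftarrow>Ls. fst (snd L)) + d + 3"
  have "(\<lambda>n. real (K * Suc n ^ Suc d)) \<in> O(\<lambda>n. real n ^ Suc d)"
  proof (rule bigoI)
    have "K * Suc n ^ Suc d \<le> (K * 2 ^ Suc d) * n ^ Suc d" if "n \<ge> 1" for n
    proof -
      have "Suc n ^ Suc d \<le> (2 * n) ^ Suc d" using that by (intro power_mono) auto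
      then show ?thesis by (simp only: power_mult_distrib mult.assoc mult_le_mono2)
    qed
    then have "real (K * Suc n ^ Suc d) \<le> real (K * 2 ^ Suc d) * real n ^ Suc d" if "n \<ge> 1" for n
      using that by (metis of_nat_le_iff of_nat_mult of_nat_power)
    then show "\<forall>\<^sub>F n in sequentially. norm (real (K * Suc n ^ Suc d))
        \<le> real (K * 2 ^ Suc d) * norm (real n ^ Suc d)"
      by (intro eventually_sequentiallyI[of 1]) simp
  qed
  moreover have "\<exists>t s. run ((n + 2) ^ k) (layers_prog Ls) (input_memory G) t s \<and>
      t \<le> K * Suc n ^ Suc d \<and> Q G s"
    if G: "n \<ge> 1" "verts G = {0..<n}" "simple_graph G" "P G" for G n
  proof -
    define K' where "K' = (\<Sum>L\<leftarrow>Ls. fst (snd L)) + d"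
    \<comment> \<open>The base \<open>n + 2\<close> is at least 2, so the power with exponent
      \<open>K'\<close> absorbs the constant \<open>K'\<close>; three more factors leave room for
      the quadratic part.\<close>
    have "K' < 2 ^ K'" by (rule less_exp)
    also have "2 ^ K' \<le> (n + 2) ^ K'" by (intro power_mono) auto
    finally have "K' + 1 \<le> (n + 2) ^ K'" by simp
    then have "(n + 2) ^ 3 * (K' + 1) \<le> (n + 2) ^ 3 * (n + 2) ^ K'" by (rule mult_le_mono2)
    moreover have "n * n + n + K' + 1 \<le> (n + 2) ^ 3 * (K' + 1)"
      by (simp add: power3_eq_cube algebra_simps)
    moreover have "k = 3 + K'" by (simp add: k_def K'_def)
    ultimately have w: "n * n + n + K' + 1 \<le> (n + 2) ^ k" by (simp add: power_add)
    have "\<exists>t s'. run ((n + 2) ^ k) (layers_prog Ls) (input_memory G) t s' \<and>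
        t \<le> (\<Sum>L\<leftarrow>Ls. layer_time n L) + 1 \<and> same_data (foldl apply_layer (input_memory G) Ls) s'"
      \<comment> \<open>The input holds only 0, 1 and \<open>n\<close>, all at most \<open>n\<close>
        because \<open>n \<ge> 1\<close>.\<close>
      by (rule layers_run[OF layers, where m = n])
        (use w G in \<open>auto simp: K'_def input_memory_def\<close>)
    then obtain t s' where s': "run ((n + 2) ^ k) (layers_prog Ls) (input_memory G) t s'"
        "t \<le> (\<Sum>L\<leftarrow>Ls. layer_time n L) + 1" "same_data (foldl apply_layer (input_memory G) Ls) s'"
      by blast
    have "(\<Sum>L\<leftarrow>Ls. layer_time n L) \<le> (\<Sum>L\<leftarrow>Ls. (time_factor (snd (snd L)) + 32) * Suc n ^ Suc d)"
    proof (rule sum_list_mono)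
      fix L assume "L \<in> set Ls"
      with layers show "layer_time n L \<le> (time_factor (snd (snd L)) + 32) * Suc n ^ Suc d"
        using layer_time_le[of "snd (snd L)" d n "fst L" "fst (snd L)"] by auto
    qed
    also have "\<dots> = (\<Sum>L\<leftarrow>Ls. time_factor (snd (snd L)) + 32) * Suc n ^ Suc d"
      by (rule sum_list_mult_const)
    finally have "(\<Sum>L\<leftarrow>Ls. layer_time n L) + 1 \<le>
        (\<Sum>L\<leftarrow>Ls. time_factor (snd (snd L)) + 32) * Suc n ^ Suc d + 1 * Suc n ^ Suc d"
      by (intro add_le_mono) (simp_all del: power_Suc)
    also have "\<dots> = K * Suc n ^ Suc d" unfolding K_def add_mult_distrib ..
    finally show ?thesis using s' correct[OF G s'(3)] le_trans by blast
  qed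
  ultimately show ?thesis unfolding computable_in_time_def
    by (intro exI[of _ "layers_prog Ls"] exI[of _ k] exI[of _ "\<lambda>n. K * Suc n ^ Suc d"]) blast
qed

section \<open>Candidates for the right side\<close>

definition branching :: "'a ugraph \<Rightarrow> 'a \<Rightarrow> bool" where
  "branching G v \<longleftrightarrow> (\<exists>x y. x \<noteq> y \<and> adjacent G x v \<and> adjacent G y v)"

text \<open>A common neighbor forces the same side. Conversely, if two vertices of one side had no
  common neighbor, two neighbors of each would give a 2P3. As the left-hand side does not mention
  the bipartition, all bipartitions agree on which branching vertices lie together.\<close>

lemma branching_same_side:
  assumes bg: "labeled_bigraph G A B" and free: "two_P3_free G"
    and br: "branching G u" "branching G v"
  shows "(\<exists>x. adjacent G x u \<and> adjacent G x v) \<longleftrightarrow> (u \<in> A \<longleftrightarrow> v \<in> A)"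
proof
  assume "\<exists>x. adjacent G x u \<and> adjacent G x v"
  then obtain x where "adjacent G x u" "adjacent G x v" by blast
  with bg show "u \<in> A \<longleftrightarrow> v \<in> A" unfolding labeled_bigraph_iff by metis
next
  assume side: "u \<in> A \<longleftrightarrow> v \<in> A"
  from br obtain x y x' y' where
    "x \<noteq> y" "adjacent G x u" "adjacent G y u" "x' \<noteq> y'" "adjacent G x' v" "adjacent G y' v"
    unfolding branching_def by (elim exE conjE) blast
  with two_P3_free_same_side[OF bg free side, of x y x' y']
  show "\<exists>x. adjacent G x u \<and> adjacent G x v" by metis
qed

text \<open>A violation in \<open>P\<close> has a common neighbor \<open>w\<close>, which is
  branching and outside \<open>P\<close>; a violation in \<open>Q\<close> yields \<open>w'\<close>
  outside \<open>Q\<close>, hence in \<open>P\<close>. So \<open>w\<close> and \<open>w'\<close> are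
  separated by this bipartition, and by \<open>branching_same_side\<close> by every other. One of
  them lies in \<open>A\<close>, and then its violating pair lies in \<open>B\<close>.\<close>

lemma not_right_Sperner_if_both_fail:
  assumes free: "two_P3_free G"
    and P: "labeled_bigraph G (verts G - P) P" "\<not> right_Sperner_labeled G (verts G - P) P"
    and Q: "labeled_bigraph G (verts G - Q) Q" "\<not> right_Sperner_labeled G (verts G - Q) Q"
    and opp: "\<And>x y. adjacent G x y \<Longrightarrow> x \<in> P \<longleftrightarrow> x \<notin> Q"
    and deg: "\<And>x. x \<in> P \<union> Q \<Longrightarrow> \<exists>y. adjacent G y x"
  shows "\<not> right_Sperner G"
proof
  assume "right_Sperner G"
  then obtain A B where rs: "right_Sperner_labeled G A B" by (auto simp: right_Sperner_def)
  then have bg: "labeled_bigraph G A B" by (simp add: right_Sperner_labeled_def)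
  then have sg: "simple_graph G" by (simp add: labeled_bigraph_iff)
  have bad: "\<exists>u v w. u \<noteq> v \<and> u \<in> R \<and> v \<in> R \<and> nbhd G u \<subseteq> nbhd G v \<and> adjacent G w u \<and> adjacent G w v"
    if R: "labeled_bigraph G (verts G - R) R" "\<not> right_Sperner_labeled G (verts G - R) R"
      "R \<subseteq> P \<union> Q" for R
  proof -
    from R(1,2) obtain u v where uv: "u \<in> R" "v \<in> R" "nbhd G u \<subseteq> nbhd G v" "u \<noteq> v"
      unfolding right_Sperner_labeled_def by blast
    with R(3) deg obtain w where "adjacent G w u" by blast
    moreover from this uv(3) have "adjacent G w v" unfolding subset_iff nbhd_iff[OF sg] by blast
    ultimately show ?thesis using uv by blast
  qed
  obtain u v w where u: "u \<noteq> v" "u \<in> P" "v \<in> P" "nbhd G u \<subseteq> nbhd G v" "adjacent G w u" "adjacent G w v"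
    using bad[OF P] by blast
  obtain u' v' w' where u': "u' \<noteq> v'" "u' \<in> Q" "v' \<in> Q" "nbhd G u' \<subseteq> nbhd G v'"
    "adjacent G w' u'" "adjacent G w' v'"
    using bad[OF Q] by blast
  have br: "branching G w" "branching G w'"
    unfolding branching_def using u u' adjacent_sym by metis+
  have altP: "x \<in> P \<longleftrightarrow> y \<notin> P" if "adjacent G x y" for x y
    using P(1) that adjacent_verts[OF sg that] unfolding labeled_bigraph_iff by blast
  have altQ: "x \<in> Q \<longleftrightarrow> y \<notin> Q" if "adjacent G x y" for x y
    using Q(1) that adjacent_verts[OF sg that] unfolding labeled_bigraph_iff by blast
  have "w \<notin> P" using altP[OF u(5)] u(2) by simp
  moreover have "w' \<in> P" using altQ[OF u'(5)] u'(2) opp[OF u'(5)] by simp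
  moreover have "w \<in> verts G" using adjacent_verts[OF sg u(5)] by simp
  ultimately have "\<not> (\<exists>x. adjacent G x w \<and> adjacent G x w')"
    using branching_same_side[OF P(1) free br] by simp
  then have "w \<in> A \<longleftrightarrow> w' \<notin> A"
    using branching_same_side[OF bg free br] by simp
  have AB: "y \<in> B" if "x \<in> A" "adjacent G x y" for x y
    using bg that adjacent_verts[OF sg that(2)] unfolding labeled_bigraph_iff by blast
  have no: False if "a \<noteq> b" "nbhd G a \<subseteq> nbhd G b" "adjacent G c a" "adjacent G c b" "c \<in> A" for a b c
    using rs that AB unfolding right_Sperner_labeled_def by metis
  show False
  proof (cases "w \<in> A")
    case True
    then show False by (rule no[OF u(1,4,5,6)])
  next
    case False
    with \<open>w \<in> A \<longleftrightarrow> w' \<notin> A\<close> have "w' \<in> A" by simp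
    then show False by (rule no[OF u'(1,4,5,6)])
  qed
qed

section \<open>Two opposite candidates for the right side\<close>

definition root_vertex :: "nat ugraph \<Rightarrow> nat \<Rightarrow> bool" where
  "root_vertex G r \<longleftrightarrow> branching G r \<and> (\<forall>v<r. \<not> branching G v)"

text \<open>For a branching vertex this tells in first-order terms whether it is on the side of the
  root, by \<open>branching_same_side\<close>.\<close>

definition near_root :: "nat ugraph \<Rightarrow> nat \<Rightarrow> bool" where
  "near_root G v \<longleftrightarrow> (\<exists>r. root_vertex G r \<and> (\<exists>x. adjacent G x v \<and> adjacent G x r))"

text \<open>Here \<open>w\<close> stands for a neighbor of \<open>v\<close>. A vertex of degree 1
  takes the color opposite to its neighbor; if the neighbor has degree 1 too, the edge is a
  component and the vertex numbers break the tie.\<close>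

definition in_front :: "nat ugraph \<Rightarrow> nat \<Rightarrow> nat \<Rightarrow> bool" where
  "in_front G v w \<longleftrightarrow> branching G v \<and> near_root G v \<or>
     \<not> branching G v \<and> (branching G w \<and> \<not> near_root G w \<or> \<not> branching G w \<and> v < w)"

text \<open>Membership requires a neighbor, in \<open>front\<close> and \<open>rear\<close> alike:
  an isolated vertex has an empty neighborhood, contained in every other, and so goes to the
  left.\<close>

definition front :: "nat ugraph \<Rightarrow> nat set" where
  "front G = {v. \<exists>w. adjacent G v w \<and> in_front G v w}"

definition rear :: "nat ugraph \<Rightarrow> nat set" where
  "rear G = {v. \<exists>w. adjacent G v w \<and> \<not> in_front G v w}"

text \<open>Both truth values compare the side of a vertex with that of the least branching vertex,
  and an edge changes sides.\<close>

lemma near_root_alternates: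
  assumes bg: "labeled_bigraph G A B" and free: "two_P3_free G"
    and br: "branching G u" "branching G v" and uv: "adjacent G u v"
  shows "near_root G u \<longleftrightarrow> \<not> near_root G v"
proof -
  define r where "r = (LEAST r. branching G r)"
  have "branching G r" unfolding r_def using br(1) by (rule LeastI)
  moreover have "\<not> branching G x" if "x < r" for x
    using that unfolding r_def by (rule not_less_Least)
  ultimately have root: "root_vertex G x \<longleftrightarrow> x = r" for x
    unfolding root_vertex_def using linorder_neqE_nat[of x r] by blast
  have "near_root G x \<longleftrightarrow> (x \<in> A \<longleftrightarrow> r \<in> A)" if "branching G x" for x
    using branching_same_side[OF bg free that \<open>branching G r\<close>] by (simp add: near_root_def root)
  moreover have "u \<in> A \<longleftrightarrow> v \<notin> A" using bg uv by (simp add: labeled_bigraph_iff)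
  ultimately show ?thesis using br by blast
qed

lemma in_front_alternates:
  assumes bg: "labeled_bigraph G A B" and free: "two_P3_free G" and uv: "adjacent G u v"
  shows "in_front G u v \<longleftrightarrow> \<not> in_front G v u"
proof -
  have "u \<noteq> v" using bg uv by (auto simp: labeled_bigraph_iff)
  with near_root_alternates[OF bg free _ _ uv] show ?thesis
    unfolding in_front_def by (cases "branching G u"; cases "branching G v") auto
qed

text \<open>If \<open>u\<close> is branching, the definition looks at \<open>u\<close> alone;
  otherwise \<open>u\<close> has a single neighbor.\<close>

lemma in_front_unique:
  assumes "adjacent G u v" "adjacent G u w"
  shows "in_front G u v \<longleftrightarrow> in_front G u w"
proof (cases "branching G u")
  case False
  with assms have "v = w" unfolding branching_def by (metis adjacent_sym)
  then show ?thesis by simp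
qed (simp add: in_front_def)

lemma front_iff: "adjacent G u v \<Longrightarrow> u \<in> front G \<longleftrightarrow> in_front G u v"
  unfolding front_def using in_front_unique by blast

lemma rear_iff: "adjacent G u v \<Longrightarrow> u \<in> rear G \<longleftrightarrow> \<not> in_front G u v"
  unfolding rear_def using in_front_unique by blast

lemma labeled_bigraph_candidates:
  assumes bg: "labeled_bigraph G A B" and free: "two_P3_free G"
  shows "labeled_bigraph G (verts G - front G) (front G)" "labeled_bigraph G (verts G - rear G) (rear G)"
proof -
  have sg: "simple_graph G" using bg by (simp add: labeled_bigraph_iff)
  have sub: "front G \<subseteq> verts G" "rear G \<subseteq> verts G"
    unfolding front_def rear_def using adjacent_verts(1)[OF sg] by blast+
  have alt: "u \<in> front G \<longleftrightarrow> v \<notin> front G" "u \<in> rear G \<longleftrightarrow> v \<notin> rear G" if uv: "adjacent G u v" for u v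
  proof -
    have vu: "adjacent G v u" using uv by (simp add: adjacent_sym)
    show "u \<in> front G \<longleftrightarrow> v \<notin> front G" "u \<in> rear G \<longleftrightarrow> v \<notin> rear G"
      unfolding front_iff[OF uv] front_iff[OF vu] rear_iff[OF uv] rear_iff[OF vu]
      using in_front_alternates[OF bg free uv] by simp_all
  qed
  show "labeled_bigraph G (verts G - front G) (front G)"
    unfolding labeled_bigraph_iff
    using sg sub alt(1) adjacent_verts[OF sg] by auto
  show "labeled_bigraph G (verts G - rear G) (rear G)"
    unfolding labeled_bigraph_iff
    using sg sub alt(2) adjacent_verts[OF sg] by auto
qed

lemma right_Sperner_candidates:
  assumes bg: "labeled_bigraph G A B" and free: "two_P3_free G" and rs: "right_Sperner G"
  shows "right_Sperner_labeled G (verts G - front G) (front G) \<or>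
    right_Sperner_labeled G (verts G - rear G) (rear G)"
proof (rule ccontr)
  note cand = labeled_bigraph_candidates[OF bg free]
  assume fail: "\<not> ?thesis"
  have "\<not> right_Sperner G"
  proof (rule not_right_Sperner_if_both_fail[OF free cand(1) _ cand(2)])
    show "x \<in> front G \<longleftrightarrow> x \<notin> rear G" if "adjacent G x y" for x y
      by (simp only: front_iff[OF that] rear_iff[OF that] not_not)
    show "\<exists>y. adjacent G y x" if x: "x \<in> front G \<union> rear G" for x
    proof -
      from x obtain y where "adjacent G x y" unfolding front_def rear_def by blast
      then show ?thesis by (intro exI[of _ y]) (simp only: adjacent_sym[of G x])
    qed
  qed (use fail in simp_all)
  with rs show False by simp
qed

section \<open>The algorithm\<close>

definition Or :: "fm \<Rightarrow> fm \<Rightarrow> fm" where "Or \<phi> \<psi> = Neg (And (Neg \<phi>) (Neg \<psi>))"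

lemma Or_simps [simp]:
  "sat s l e (Or \<phi> \<psi>) \<longleftrightarrow> sat s l e \<phi> \<or> sat s l e \<psi>"
  "closed_below l (Or \<phi> \<psi>) \<longleftrightarrow> closed_below l \<phi> \<and> closed_below l \<psi>"
  "arrays (Or \<phi> \<psi>) = arrays \<phi> \<union> arrays \<psi>"
  "qdepth (Or \<phi> \<psi>) = max (qdepth \<phi>) (qdepth \<psi>)"
  by (simp_all add: Or_def)

definition in_front_fm :: fm where
  "in_front_fm = Or (And (In ''d'' 0) (In ''s'' 0))
     (And (Neg (In ''d'' 0)) (Or (And (In ''d'' 1) (Neg (In ''s'' 1))) (And (Neg (In ''d'' 1)) (Lt 0 1))))"

text \<open>Level 0 is the vertex tested, level 1 a different vertex of the candidate, and level 2
  would refute the inclusion of their neighborhoods.\<close>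

definition violation_fm :: "string \<Rightarrow> fm" where
  "violation_fm a = And (In a 0) (Ex (And (And (In a 1) (Or (Lt 0 1) (Lt 1 0)))
     (Neg (Ex (And (Edge 2 0) (Neg (Edge 2 1)))))))"

text \<open>
  The arrays hold the vertices of degree at least 2 (\<open>d\<close>), the first of them (\<open>f\<close>), the vertices with
  a common neighbor with it (\<open>s\<close>), the two candidates (\<open>p\<close>, \<open>q\<close>) and the vertices that violate the
  Sperner property in them (\<open>x\<close>, \<open>y\<close>), the chosen side \<open>B\<close> (\<open>b\<close>), the splitting vertices (\<open>g\<close>) and
  the first of them (\<open>h\<close>).
\<close>

definition algorithm :: "layer list" where
  "algorithm =
    [(''d'', 1, Ex (Ex (And (And (Edge 0 1) (Edge 0 2)) (Lt 1 2)))),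
     (''f'', 1, And (In ''d'' 0) (Neg (Ex (And (Lt 1 0) (In ''d'' 1))))),
     (''s'', 1, Ex (And (In ''f'' 1) (Ex (And (Edge 2 0) (Edge 2 1))))),
     (''p'', 1, Ex (And (Edge 0 1) in_front_fm)),
     (''q'', 1, Ex (And (Edge 0 1) (Neg in_front_fm))),
     (''x'', 1, violation_fm ''p''),
     (''y'', 1, violation_fm ''q''),
     (''ok'', 1, Neg (And (Ex (In ''x'' 1)) (Ex (In ''y'' 1)))),
     (''b'', 1, Or (And (Neg (Ex (In ''x'' 1))) (In ''p'' 0)) (And (Ex (In ''x'' 1)) (In ''q'' 0))),
     (''g'', 1, And (Neg (In ''b'' 0)) (Neg (Ex (And (And (Neg (In ''b'' 1)) (Or (Lt 0 1) (Lt 1 0)))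
        (And (Ex (And (Edge 2 1) (Edge 2 0)))
          (Ex (And (In ''b'' 2) (Neg (Or (Edge 2 1) (Edge 2 0)))))))))),
     (''h'', 1, And (In ''g'' 0) (Neg (Ex (And (Lt 1 0) (In ''g'' 1))))),
     (''part'', 1, And (And (Neg (In ''b'' 0)) (Neg (In ''h'' 0)))
        (Ex (And (In ''h'' 1) (Ex (And (Edge 2 0) (Edge 2 1)))))),
     (''part'', 2, And (And (Neg (In ''b'' 0)) (Neg (In ''h'' 0)))
        (Neg (Ex (And (In ''h'' 1) (Ex (And (Edge 2 0) (Edge 2 1))))))),
     (''part'', 3, And (In ''b'' 0) (Ex (And (In ''h'' 1) (Edge 0 1)))),
     (''part'', 4, And (In ''b'' 0) (Neg (Ex (And (In ''h'' 1) (Edge 0 1)))))]"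

lemma proper_algorithm: "\<forall>L\<in>set algorithm. proper_layer L \<and> qdepth (snd (snd L)) \<le> 2"
  by (simp add: algorithm_def in_front_fm_def violation_fm_def)

text \<open>
  No layer reads an array that it or a later layer writes, so every formula may be evaluated in the
  final memory.
\<close>

fun stratified :: "layer list \<Rightarrow> bool" where
  "stratified [] \<longleftrightarrow> True"
| "stratified ((a, k, \<phi>) # Ls) \<longleftrightarrow>
     insert ''n'' (insert ''adj'' (arrays \<phi>)) \<inter> insert a (fst ` set Ls) = {} \<and> stratified Ls"

lemma stratified_algorithm: "stratified algorithm"
  by (simp add: algorithm_def in_front_fm_def violation_fm_def)

lemma foldl_apply_layer_other: "a \<notin> fst ` set Ls \<Longrightarrow> foldl apply_layer s Ls a = s a"
  by (induction Ls arbitrary: s) auto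

text \<open>A sum over the layers, since several may write to the same array, as those for
  \<open>part\<close> do. Evaluation in the final memory turns the program into equations between
  the final arrays.\<close>

lemma foldl_apply_layer_stratified:
  assumes "stratified Ls" "\<forall>L\<in>set Ls. proper_layer L"
  shows "foldl apply_layer s Ls a x = s a x +
    (\<Sum>(b, k, \<phi>)\<leftarrow>Ls. if b = a \<and> x < s ''n'' 0 \<and> sat (foldl apply_layer s Ls) 1 (\<lambda>_. x) \<phi> then k else 0)"
  using assms
proof (induction Ls arbitrary: s)
  case (Cons L Ls)
  obtain b k \<phi> where L: "L = (b, k, \<phi>)" by (cases L)
  define s1 where "s1 = apply_layer s L"
  define F where "F = foldl apply_layer s1 Ls"
  have fresh: "c \<notin> insert b (fst ` set Ls)" if "c \<in> insert ''n'' (insert ''adj'' (arrays \<phi>))" for c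
    using that Cons.prems(1) unfolding L stratified.simps by blast
  have s1: "s1 a x = s a x + (if b = a \<and> x < s ''n'' 0 \<and> sat s 1 (\<lambda>_. x) \<phi> then k else 0)"
    by (simp add: s1_def L)
  have s1_other: "s1 c = s c" if "c \<noteq> b" for c
    using that by (simp add: s1_def L)
  have n: "s1 ''n'' = s ''n''" using fresh[of "''n''"] by (simp add: s1_other)
  have F: "F c = s c" if "c \<in> insert ''n'' (insert ''adj'' (arrays \<phi>))" for c
    using fresh[OF that] foldl_apply_layer_other[of c Ls s1] by (simp add: F_def s1_other)
  have closed: "closed_below 1 \<phi>" using Cons.prems(2) by (simp add: L)
  have sat: "sat F 1 (\<lambda>_. x) \<phi> \<longleftrightarrow> sat s 1 (\<lambda>_. x) \<phi>"
    by (rule sat_cong[OF closed]) (simp_all only: F)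
  have "stratified Ls" "\<forall>L\<in>set Ls. proper_layer L" using Cons.prems by (simp_all add: L)
  then have "F a x = s1 a x +
    (\<Sum>(b, k, \<phi>)\<leftarrow>Ls. if b = a \<and> x < s ''n'' 0 \<and> sat F 1 (\<lambda>_. x) \<phi> then k else 0)"
    unfolding F_def n[symmetric] by (rule Cons.IH)
  moreover have "foldl apply_layer s (L # Ls) = F" by (simp add: F_def s1_def)
  ultimately show ?case by (simp add: s1 sat[unfolded One_nat_def] L)
qed simp

abbreviation (input) holds :: "memory \<Rightarrow> string \<Rightarrow> nat \<Rightarrow> bool" where
  "holds s a x \<equiv> 0 < s a x"

section \<open>The final contents of the arrays\<close>

context
  fixes G :: "nat ugraph" and n :: nat and F :: memory
  assumes sg: "simple_graph G" and verts: "verts G = {0..<n}"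
    and F_def: "F = foldl apply_layer (input_memory G) algorithm"
begin

lemma input_cells:
  "input_memory G ''n'' 0 = n"
  "a \<noteq> ''n'' \<Longrightarrow> a \<noteq> ''adj'' \<Longrightarrow> input_memory G a x = 0"
  by (simp_all add: input_memory_def verts)

lemma F_size: "F ''n'' 0 = n"
proof -
  have "F ''n'' = input_memory G ''n''"
    unfolding F_def by (rule foldl_apply_layer_other) (simp add: algorithm_def)
  then show ?thesis by (simp add: input_cells)
qed

lemma F_adj: "u < n \<Longrightarrow> v < n \<Longrightarrow> holds F ''adj'' (u * n + v) \<longleftrightarrow> adjacent G u v"
proof -
  assume uv: "u < n" "v < n"
  have "F ''adj'' = input_memory G ''adj''"
    unfolding F_def by (rule foldl_apply_layer_other) (simp add: algorithm_def)
  moreover have "u' = u \<and> v' = v" if "u * n + v = u' * n + v'" "u' < n" "v' < n" for u' v'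
  proof -
    have "u = (u * n + v) div n" "v = (u * n + v) mod n" using uv by simp_all
    moreover have "u' = (u * n + v) div n" "v' = (u * n + v) mod n" using that by simp_all
    ultimately show ?thesis by simp
  qed
  ultimately show ?thesis using uv by (auto simp: input_memory_def verts)
qed

lemma F_cell:
  assumes "a \<noteq> ''n''" "a \<noteq> ''adj''"
  shows "F a x = (\<Sum>(b, k, \<phi>)\<leftarrow>algorithm. if b = a \<and> x < n \<and> sat F 1 (\<lambda>_. x) \<phi> then k else 0)"
  using foldl_apply_layer_stratified[OF stratified_algorithm, of "input_memory G" a x]
    proper_algorithm assms
  unfolding F_def[symmetric] by (simp add: input_cells)

lemma adjacent_less: "adjacent G u v \<Longrightarrow> u < n \<and> v < n"
  using adjacent_verts[OF sg] by (force simp: verts)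

lemma F_branching:
  assumes "x < n"
  shows "holds F ''d'' x \<longleftrightarrow> branching G x"
proof -
  have "holds F ''d'' x \<longleftrightarrow> (\<exists>y<n. \<exists>z<n. (adjacent G x y \<and> adjacent G x z) \<and> y < z)"
    unfolding F_cell[of "''d''", simplified] using assms
    by (simp add: algorithm_def F_size F_adj cong: conj_cong)
  also have "\<dots> \<longleftrightarrow> branching G x"
    unfolding branching_def using adjacent_less by (metis adjacent_sym linorder_neq_iff)
  finally show ?thesis .
qed

lemma branching_less: "branching G x \<Longrightarrow> x < n"
  unfolding branching_def using adjacent_less by blast

lemma F_root:
  assumes "x < n"
  shows "holds F ''f'' x \<longleftrightarrow> root_vertex G x"
proof -
  have "holds F ''f'' x \<longleftrightarrow> branching G x \<and> \<not> (\<exists>y<n. y < x \<and> branching G y)"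
    unfolding F_cell[of "''f''", simplified] using assms
    by (simp add: algorithm_def F_size F_branching cong: conj_cong)
  then show ?thesis
    unfolding root_vertex_def using branching_less by blast
qed

lemma F_near_root:
  assumes "x < n"
  shows "holds F ''s'' x \<longleftrightarrow> near_root G x"
proof -
  have "holds F ''s'' x \<longleftrightarrow> (\<exists>r<n. root_vertex G r \<and> (\<exists>y<n. adjacent G y x \<and> adjacent G y r))"
    unfolding F_cell[of "''s''", simplified] using assms
    by (simp add: algorithm_def F_size F_adj F_root cong: conj_cong)
  then show ?thesis
    unfolding near_root_def using adjacent_less by blast
qed

lemma sat_in_front:
  assumes "e 0 < n" "e 1 < n"
  shows "sat F l e in_front_fm \<longleftrightarrow> in_front G (e 0) (e 1)"
  using assms by (simp add: in_front_fm_def in_front_def F_branching F_near_root)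

lemma F_front:
  assumes "x < n"
  shows "holds F ''p'' x \<longleftrightarrow> x \<in> front G" "holds F ''q'' x \<longleftrightarrow> x \<in> rear G"
proof -
  have "holds F ''p'' x \<longleftrightarrow> (\<exists>y<n. adjacent G x y \<and> in_front G x y)"
    unfolding F_cell[of "''p''", simplified] using assms
    by (simp add: algorithm_def F_size F_adj sat_in_front cong: conj_cong)
  then show "holds F ''p'' x \<longleftrightarrow> x \<in> front G"
    unfolding front_def using adjacent_less by blast
  have "holds F ''q'' x \<longleftrightarrow> (\<exists>y<n. adjacent G x y \<and> \<not> in_front G x y)"
    unfolding F_cell[of "''q''", simplified] using assms
    by (simp add: algorithm_def F_size F_adj sat_in_front cong: conj_cong)
  then show "holds F ''q'' x \<longleftrightarrow> x \<in> rear G"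
    unfolding rear_def using adjacent_less by blast
qed

lemma sat_violation:
  assumes "\<And>x. x < n \<Longrightarrow> holds F a x \<longleftrightarrow> x \<in> R" "x < n"
  shows "sat F 1 (\<lambda>_. x) (violation_fm a) \<longleftrightarrow>
    x \<in> R \<and> (\<exists>y<n. y \<in> R \<and> x \<noteq> y \<and> nbhd G x \<subseteq> nbhd G y)"
proof -
  have "sat F 1 (\<lambda>_. x) (violation_fm a) \<longleftrightarrow> x \<in> R \<and> (\<exists>y<n. (y \<in> R \<and> (x < y \<or> y < x)) \<and>
      \<not> (\<exists>z<n. adjacent G z x \<and> \<not> adjacent G z y))"
    using assms by (simp add: violation_fm_def F_size F_adj cong: conj_cong)
  moreover have "nbhd G x \<subseteq> nbhd G y \<longleftrightarrow> \<not> (\<exists>z<n. adjacent G z x \<and> \<not> adjacent G z y)" for y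
    using adjacent_less unfolding subset_iff nbhd_iff[OF sg] by blast
  ultimately show ?thesis by (simp add: linorder_neq_iff[of x] conj_ac)
qed

lemma not_right_Sperner_labeled_iff:
  assumes bg: "labeled_bigraph G (verts G - R) R"
  shows "\<not> right_Sperner_labeled G (verts G - R) R \<longleftrightarrow>
    (\<exists>x<n. x \<in> R \<and> (\<exists>y<n. y \<in> R \<and> x \<noteq> y \<and> nbhd G x \<subseteq> nbhd G y))"
proof -
  have "R \<subseteq> verts G" using bg unfolding labeled_bigraph_iff by blast
  then have "x < n" if "x \<in> R" for x using that unfolding verts by auto
  moreover have "right_Sperner_labeled G (verts G - R) R \<longleftrightarrow>
      (\<forall>x\<in>R. \<forall>y\<in>R. nbhd G x \<subseteq> nbhd G y \<longrightarrow> x = y)"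
    unfolding right_Sperner_labeled_def using bg by simp
  ultimately show ?thesis by metis
qed

lemma F_violation:
  assumes "labeled_bigraph G (verts G - front G) (front G)" "labeled_bigraph G (verts G - rear G) (rear G)"
  shows "(\<exists>x<n. holds F ''x'' x) \<longleftrightarrow> \<not> right_Sperner_labeled G (verts G - front G) (front G)"
    "(\<exists>x<n. holds F ''y'' x) \<longleftrightarrow> \<not> right_Sperner_labeled G (verts G - rear G) (rear G)"
proof -
  have x: "holds F ''x'' x \<longleftrightarrow> sat F 1 (\<lambda>_. x) (violation_fm ''p'')" if "x < n" for x
    unfolding F_cell[of "''x''", simplified] using that by (simp add: algorithm_def)
  have y: "holds F ''y'' x \<longleftrightarrow> sat F 1 (\<lambda>_. x) (violation_fm ''q'')" if "x < n" for x
    unfolding F_cell[of "''y''", simplified] using that by (simp add: algorithm_def)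
  show "(\<exists>x<n. holds F ''x'' x) \<longleftrightarrow> \<not> right_Sperner_labeled G (verts G - front G) (front G)"
    unfolding not_right_Sperner_labeled_iff[OF assms(1)]
    by (simp only: x sat_violation[OF F_front(1)] cong: conj_cong)
  show "(\<exists>x<n. holds F ''y'' x) \<longleftrightarrow> \<not> right_Sperner_labeled G (verts G - rear G) (rear G)"
    unfolding not_right_Sperner_labeled_iff[OF assms(2)]
    by (simp only: y sat_violation[OF F_front(2)] cong: conj_cong)
qed

text \<open>The formula does not mention the vertex, so the verdict is written to
  \<open>ok[x]\<close> for every vertex \<open>x\<close>; cell 0 is among these because
  \<open>n \<ge> 1\<close>.\<close>

lemma F_ok:
  assumes "1 \<le> n"
  shows "F ''ok'' 0 = of_bool (\<not> ((\<exists>x<n. holds F ''x'' x) \<and> (\<exists>x<n. holds F ''y'' x)))"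
  unfolding F_cell[of "''ok''", simplified] using assms by (simp add: algorithm_def F_size)

lemma F_right:
  assumes "x < n"
  shows "holds F ''b'' x \<longleftrightarrow> x \<in> (if \<exists>y<n. holds F ''x'' y then rear G else front G)"
  unfolding F_cell[of "''b''", simplified] using assms by (auto simp: algorithm_def F_size F_front)

definition rights :: "nat set" where "rights = {x. x < n \<and> holds F ''b'' x}"

lemma F_splitting:
  assumes "x < n"
  shows "holds F ''g'' x \<longleftrightarrow> splitting_vertex G (verts G - rights) rights x"
proof -
  have "holds F ''g'' x \<longleftrightarrow> x \<notin> rights \<and> \<not> (\<exists>y<n. (y \<notin> rights \<and> (x < y \<or> y < x)) \<and>
      (\<exists>z<n. adjacent G z y \<and> adjacent G z x) \<and>
      (\<exists>z<n. z \<in> rights \<and> \<not> (adjacent G z y \<or> adjacent G z x)))"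
    unfolding F_cell[of "''g''", simplified] using assms
    by (simp add: algorithm_def F_size F_adj rights_def cong: conj_cong)
  moreover have "(\<exists>z<n. adjacent G z y \<and> adjacent G z x) \<longleftrightarrow> nbhd G y \<inter> nbhd G x \<noteq> {}" for y
    using adjacent_less unfolding set_eq_iff Int_iff nbhd_iff[OF sg] by blast
  moreover have "(\<exists>z<n. z \<in> rights \<and> \<not> (adjacent G z y \<or> adjacent G z x)) \<longleftrightarrow>
      \<not> rights \<subseteq> nbhd G y \<union> nbhd G x" for y
    unfolding subset_iff Un_iff nbhd_iff[OF sg] by (auto simp: rights_def)
  moreover have "x < y \<or> y < x \<longleftrightarrow> y \<noteq> x" for y by auto
  ultimately have g: "holds F ''g'' x \<longleftrightarrow> x \<notin> rights \<and> \<not> (\<exists>y<n. (y \<notin> rights \<and> y \<noteq> x) \<and>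
      nbhd G y \<inter> nbhd G x \<noteq> {} \<and> \<not> rights \<subseteq> nbhd G y \<union> nbhd G x)"
    by (simp only:)
  \<comment> \<open>What remains is propositional: \<open>I\<close> stands for disjointness of the
    neighborhoods and \<open>C\<close> for covering the right side.\<close>
  have "x \<notin> R \<and> \<not> (\<exists>y<n. (y \<notin> R \<and> y \<noteq> x) \<and> \<not> I y \<and> \<not> C y) \<longleftrightarrow>
      x \<in> {0..<n} - R \<and> (\<forall>y\<in>{0..<n} - R. y \<noteq> x \<longrightarrow> I y \<or> C y)" for R I C
    using assms by auto
  then show ?thesis
    unfolding g splitting_vertex_def verts .
qed

lemma F_first_splitting:
  assumes "x < n"
  shows "holds F ''h'' x \<longleftrightarrow> splitting_vertex G (verts G - rights) rights x \<and>
    \<not> (\<exists>y<x. splitting_vertex G (verts G - rights) rights y)"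
proof -
  have "holds F ''h'' x \<longleftrightarrow> splitting_vertex G (verts G - rights) rights x \<and>
      \<not> (\<exists>y<n. y < x \<and> splitting_vertex G (verts G - rights) rights y)"
    unfolding F_cell[of "''h''", simplified] using assms
    by (simp add: algorithm_def F_size F_splitting cong: conj_cong)
  with assms show ?thesis by auto
qed

text \<open>\<open>part\<close> starts at 0 and the conditions of its four layers exclude each
  other, so the sum is the index of the part; outside \<open>rights\<close>, the vertex
  \<open>z\<close> meets none of them and keeps 0.\<close>

lemma F_part:
  assumes "x < n" and z: "\<And>y. y < n \<Longrightarrow> holds F ''h'' y \<longleftrightarrow> y = z" and "z < n"
  shows "F ''part'' x =
    (if x \<in> rights then if adjacent G x z then 3 else 4
     else if x = z then 0 else if \<exists>y. adjacent G y x \<and> adjacent G y z then 1 else 2)"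
proof -
  have meet: "(\<exists>y. adjacent G y x \<and> adjacent G y z) \<longleftrightarrow> (\<exists>y<n. adjacent G y x \<and> adjacent G y z)"
    using adjacent_less by blast
  have ex: "(\<exists>y<n. holds F ''h'' y \<and> Q y) \<longleftrightarrow> Q z" for Q
    using z \<open>z < n\<close> by blast
  show ?thesis
    unfolding F_cell[of "''part''", simplified] meet using assms(1) z[OF assms(1)] \<open>z < n\<close>
    by (simp add: algorithm_def F_size F_adj ex rights_def cong: conj_cong)
qed

lemma F_correct:
  assumes "1 \<le> n" and free: "two_P3_free G" and "bigraph G"
    and s: "s ''ok'' = F ''ok''" "s ''part'' = F ''part''"
  shows "correct_output G s"
proof -
  from \<open>bigraph G\<close> obtain A B where bg: "labeled_bigraph G A B" by (auto simp: bigraph_def)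
  note cand = labeled_bigraph_candidates[OF bg free]
  note viol = F_violation[OF cand]
  have rights: "rights = (if right_Sperner_labeled G (verts G - front G) (front G) then front G else rear G)"
  proof -
    have "front G \<subseteq> {0..<n}" "rear G \<subseteq> {0..<n}"
      unfolding front_def rear_def using adjacent_less by auto
    then show ?thesis by (auto simp: rights_def F_right viol(1))
  qed
  show ?thesis
  proof (cases "right_Sperner G")
    case False
    then have "F ''ok'' 0 = 0"
      unfolding F_ok[OF assms(1)] viol by (auto simp: right_Sperner_def)
    with False s show ?thesis by (simp add: correct_output_def)
  next
    case True
    from right_Sperner_candidates[OF bg free True]
    have rs: "right_Sperner_labeled G (verts G - rights) rights" and ok: "F ''ok'' 0 = 1"
      unfolding F_ok[OF assms(1)] viol rights by auto
    let ?A = "verts G - rights"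
    \<comment> \<open>Otherwise vertex 0 would be in \<open>rights\<close>; as a member of a
      candidate it has a neighbor, which would have to lie on the empty left side.\<close>
    have "?A \<noteq> {}"
    proof
      assume A: "?A = {}"
      with verts \<open>1 \<le> n\<close> have "0 \<in> rights" by auto
      then obtain y where "adjacent G 0 y"
        unfolding rights front_def rear_def by (auto split: if_splits)
      with rs A show False unfolding right_Sperner_labeled_def labeled_bigraph_iff by blast
    qed
    then obtain z0 where z0: "splitting_vertex G ?A rights z0"
      using splitting_vertex_exists[OF rs free] by blast
    \<comment> \<open>The least one is taken because the array \<open>h\<close> marks the first
      splitting vertex.\<close>
    define z where "z = (LEAST z. splitting_vertex G ?A rights z)"
    have z: "splitting_vertex G ?A rights z" unfolding z_def using z0 by (rule LeastI)
    have least: "\<not> splitting_vertex G ?A rights y" if "y < z" for y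
      using that unfolding z_def by (rule not_less_Least)
    have zn: "z < n" "z \<notin> rights" using z by (auto simp: splitting_vertex_def verts)
    have h: "holds F ''h'' y \<longleftrightarrow> y = z" if "y < n" for y
      unfolding F_first_splitting[OF that] using z least by (metis linorder_neqE_nat)
    note part = F_part[OF _ h zn(1)]
    have rsub: "rights \<subseteq> verts G" by (auto simp: rights_def verts)
    have out: "output_part G s i = {x \<in> verts G. F ''part'' x = i}" for i
      by (simp add: output_part_def s)
    define A1 where "A1 = {a \<in> ?A - {z}. nbhd G a \<inter> nbhd G z \<noteq> {}}"
    define A2 where "A2 = {a \<in> ?A - {z}. nbhd G a \<inter> nbhd G z = {}}"
    define B1 where "B1 = rights \<inter> nbhd G z"
    define B2 where "B2 = rights - nbhd G z"
    have meet: "nbhd G a \<inter> nbhd G z = {} \<longleftrightarrow> \<not> (\<exists>y. adjacent G y a \<and> adjacent G y z)" for a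
      unfolding set_eq_iff Int_iff nbhd_iff[OF sg] by blast
    have parts: "output_part G s 0 = {z}" "output_part G s 1 = A1" "output_part G s 2 = A2"
      "output_part G s 3 = B1" "output_part G s 4 = B2"
      unfolding out A1_def A2_def B1_def B2_def meet
      using zn rsub by (auto simp: verts part nbhd_iff[OF sg] split: if_splits)
    have "Sperner_decomposition G ?A rights z A1 A2 B1 B2"
      by (rule Sperner_decomposition_splitting_vertex[OF rs free z A1_def A2_def B1_def B2_def])
    moreover have "?A = {z} \<union> A1 \<union> A2" "rights = B1 \<union> B2"
      using zn by (auto simp: A1_def A2_def B1_def B2_def verts)
    ultimately show ?thesis
      unfolding correct_output_def parts using rs ok s(1) by metis
  qed
qed

end

theorem theorem5p5:
  shows "(\<forall>(G :: 'a ugraph) A B.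
            simple_graph G \<and> two_P3_free G \<and> right_Sperner G \<and> card (verts G) \<ge> 2 \<and>
            right_Sperner_labeled G A B \<longrightarrow>
            (\<exists>z A1 A2 B1 B2. Sperner_decomposition G A B z A1 A2 B1 B2)) \<and>
         computable_in_time (\<lambda>n. real n ^ 3) (\<lambda>G. two_P3_free G \<and> bigraph G) correct_output"
proof
  show "\<forall>(G :: 'a ugraph) A B.
      simple_graph G \<and> two_P3_free G \<and> right_Sperner G \<and> card (verts G) \<ge> 2 \<and>
      right_Sperner_labeled G A B \<longrightarrow>
      (\<exists>z A1 A2 B1 B2. Sperner_decomposition G A B z A1 A2 B1 B2)"
    using Sperner_decomposition_exists by blast
  have "computable_in_time (\<lambda>n. real n ^ Suc 2) (\<lambda>G. two_P3_free G \<and> bigraph G) correct_output"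
  proof (rule layers_computable[OF proper_algorithm])
    fix G :: "nat ugraph" and n s
    assume "n \<ge> 1" "verts G = {0..<n}" "simple_graph G" "two_P3_free G \<and> bigraph G"
      "same_data (foldl apply_layer (input_memory G) algorithm) s"
    then show "correct_output G s"
      by (intro F_correct[OF _ _ refl]) (simp_all add: same_data_def)
  qed
  then show "computable_in_time (\<lambda>n. real n ^ 3) (\<lambda>G. two_P3_free G \<and> bigraph G) correct_output"
    by simp
qed

end
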